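(* Let $\mathcal{G}$ be a connected finite metric graph with non-empty set of boundary vertices, let $\tfrac12<\beta<1$, and let $p,r\in C[\mathcal{G}]$ satisfy $0<a_0\le p^{(i)}\le a_1<+\infty$ and $0<R_0\le r^{(i)}\le R_1<+\infty$ on every edge $e_i$. Let $\lambda_1\le\lambda_2\le\dots$ be the eigenvalues, repeated according to multiplicity, of the fractional Sturm–Liouville problem on $\mathcal{G}$ described in the context, with corresponding eigenfunctions $u_k$ orthonormal with respect to $\int_{\mathcal{G}} r u v\,d\mathcal{G}$. Then the series $\sum_{k=1}^\infty\frac1{\lambda_k}$ is convergent, and $$\big|I^{1-\beta}_{0,x}u_k\big|\le C\left(1+\sqrt{\lambda_k}\right)\quad\text{on }\mathcal{G}\text{ for all }k\ge1,$$ where the constant $C$ (independent of $k$ and of the point of $\mathcal{G}$) depends on $R_0$, $a_0$, $\beta$ and the lengths of the edges of $\mathcal{G}$.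
   Context: All functions are real-valued. Graph. A metric graph $\mathcal{G}$ has finitely many vertices $V$ and finitely many edges $e_1,\dots,e_n$; edge $e_i$ has length $l_i>0$ and is identified with the interval $(0,l_i)$ with coordinate $x$ (so it has a left end $x=0$ and a right end $x=l_i$). An edge $e$ is incident with a vertex $\nu$ (written $e\sim\nu$) if $\nu$ is an end of $e$; the valency of $\nu$ is the number of edges incident with it; $\nu$ is a boundary vertex if its valency is one; $\partial\mathcal{G}\subset V$ is the set of boundary vertices. For $u:\mathcal{G}\to\mathbb{R}$ write $u^{(i)}=u|_{e_i}$ and $\int_{\mathcal{G}}u\,d\mathcal{G}=\sum_{i=1}^n\int_0^{l_i}u^{(i)}(x)\,dx$. $C[\mathcal{G}]$ is the space of functions uniformly continuous on each edge; $C(\mathcal{G})$ is the space of functions continuous on the whole graph (i.e. continuous up to the ends of each edge, with agreeing limits at every vertex along all incident edge ends). $L_2(\mathcal{G})=\bigoplus_i L_2(0,l_i)$ with $(u,v)_{L_2(\mathcal{G})}=\int_{\mathcal{G}}uv\,d\mathcal{G}$. Fractional operators. For $0<\alpha<1$, $I^\alpha_{0,x}y(x)=\frac1{\Gamma(\alpha)}\int_0^x\frac{y(\xi)}{(x-\xi)^{1-\alpha}}d\xi$; the left Riemann–Liouville derivative is $D^\beta_{0,x}y=\frac{d}{dx}I^{1-\beta}_{0,x}y$; the right Caputo derivative is $\partial^\beta_{x,l}y(x)=\frac{-1}{\Gamma(1-\beta)}\int_x^l\frac{y'(\xi)}{(\xi-x)^\beta}d\xi$. Put $D_+^\beta u=(D^\beta_{0,x}u^{(1)},\dots,D^\beta_{0,x}u^{(n)})$.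 Spaces. $AC^{\beta,2}_0(0,l)$ is the set of functions $f$ with $f(x)=\frac{c_0}{\Gamma(\beta)}x^{\beta-1}+I^\beta_{0,x}\phi(x)$ for a.e. $x\in[0,l]$, for some $c_0\in\mathbb{R}$, $\phi\in L_2(0,l)$ (then $I^{1-\beta}_{0,x}f(x)=c_0+\int_0^x\phi$, taken as its continuous representative, and $D^\beta_{0,x}f=\phi$). $\mathcal{H}^\beta_+(0,l)=AC^{\beta,2}_0(0,l)\cap L_2(0,l)$. $\mathcal{H}^\beta_+(\mathcal{G})=\{u\in\bigoplus_{i=1}^n\mathcal{H}^\beta_+(0,l_i): I^{1-\beta}_{0,x}u\in C(\mathcal{G})\}$, where $I^{1-\beta}_{0,x}$ is applied edgewise, and $\mathcal{H}^\beta_{+,Dir}(\mathcal{G})=\{u\in\mathcal{H}^\beta_+(\mathcal{G}): I^{1-\beta}_{0,x}u|_{\partial\mathcal{G}}=0\}$. Eigenvalue problem. On each edge, $\partial^\beta_{x,l_i}\big(p^{(i)}(x)D^\beta_{0,x}u^{(i)}(x)\big)=\lambda r^{(i)}(x)u^{(i)}(x)$; at each interior vertex $\nu\in V\setminus\partial\mathcal{G}$, $I^{1-\beta}_{0,x}u$ is continuous and $\sum_{e_i\sim\nu}\sigma_{e_i,\nu}\,p^{(i)}(\nu)D^\beta_{0,x}u^{(i)}(\nu)=0$, where $\sigma_{e_i,\nu}=1$ if $\nu$ is the right end of $e_i$ and $-1$ if it is the left end; at each $\nu\in\partial\mathcal{G}$, $I^{1-\beta}_{0,x}u(\nu)=0$.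 A generalized solution is a $u\in\mathcal{H}^\beta_{+,Dir}(\mathcal{G})$ with $$\big(p\,D_+^\beta u,D_+^\beta w\big)_{L_2(\mathcal{G})}=\lambda\,(r u,w)_{L_2(\mathcal{G})}\quad\text{for all } w\in\mathcal{H}^\beta_{+,Dir}(\mathcal{G}).$$ $\lambda$ is an eigenvalue with eigenfunction $u$ if $u\neq0$ is a generalized solution for this $\lambda$. The eigenvalues form a sequence $0<\lambda_1\le\lambda_2\le\dots$ tending to infinity, and the eigenfunctions can be chosen orthonormal with respect to $\int_{\mathcal{G}} r u v\,d\mathcal{G}$. *)

theory Defs
  imports "HOL-Analysis.Analysis" "Graph_Theory.Digraph_Component"
begin

text \<open>
  A finite metric graph is a finite multigraph (loops and parallel edges allowed) whose edges carry
  positive lengths.  An edge e is identified with the open interval from 0 to l e; its orientation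
  records the coordinate, i.e. the left end (x = 0) of e is its tail and the right end (x = l e) is
  its head.  Connectedness is the library notion for digraphs, which ignores the orientation.
\<close>

definition metric_graph :: "('v, 'e) pre_digraph \<Rightarrow> ('e \<Rightarrow> real) \<Rightarrow> bool" where
  "metric_graph G l \<longleftrightarrow> fin_digraph G \<and> (\<forall>e\<in>arcs G. 0 < l e)"

definition valency :: "('v, 'e) pre_digraph \<Rightarrow> 'v \<Rightarrow> nat" where
  "valency G v = card {e \<in> arcs G. tail G e = v \<or> head G e = v}"

definition boundary_verts :: "('v, 'e) pre_digraph \<Rightarrow> 'v set" where
  "boundary_verts G = {v \<in> verts G. valency G v = 1}"

text \<open>
  A function on the graph is given by its restrictions to the edges, g e x with e an edge and
  0 < x < l e.  Its value at a vertex is the common limit along all incident edge ends.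
\<close>

definition has_vertex_value ::
    "('v, 'e) pre_digraph \<Rightarrow> ('e \<Rightarrow> real) \<Rightarrow> ('e \<Rightarrow> real \<Rightarrow> real) \<Rightarrow> 'v \<Rightarrow> real \<Rightarrow> bool" where
  "has_vertex_value G l g v y \<longleftrightarrow>
     (\<forall>e\<in>arcs G. (tail G e = v \<longrightarrow> (g e \<longlongrightarrow> y) (at_right 0)) \<and>
                (head G e = v \<longrightarrow> (g e \<longlongrightarrow> y) (at_left (l e))))"

definition continuous_on_graph ::
    "('v, 'e) pre_digraph \<Rightarrow> ('e \<Rightarrow> real) \<Rightarrow> ('e \<Rightarrow> real \<Rightarrow> real) \<Rightarrow> bool" where
  "continuous_on_graph G l g \<longleftrightarrow>
     (\<forall>e\<in>arcs G. continuous_on {0<..<l e} (g e)) \<and> (\<forall>v\<in>verts G. \<exists>y. has_vertex_value G l g v y)"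

definition edgewise_uniformly_continuous ::
    "('v, 'e) pre_digraph \<Rightarrow> ('e \<Rightarrow> real) \<Rightarrow> ('e \<Rightarrow> real \<Rightarrow> real) \<Rightarrow> bool" where
  "edgewise_uniformly_continuous G l g \<longleftrightarrow>
     (\<forall>e\<in>arcs G. uniformly_continuous_on {0<..<l e} (g e))"

definition graph_inner ::
    "('v, 'e) pre_digraph \<Rightarrow> ('e \<Rightarrow> real) \<Rightarrow> ('e \<Rightarrow> real \<Rightarrow> real) \<Rightarrow> ('e \<Rightarrow> real \<Rightarrow> real) \<Rightarrow> real" where
  "graph_inner G l f g = (\<Sum>e\<in>arcs G. LINT x|lebesgue_on {0<..<l e}. f e x * g e x)"

definition graph_ae_zero ::
    "('v, 'e) pre_digraph \<Rightarrow> ('e \<Rightarrow> real) \<Rightarrow> ('e \<Rightarrow> real \<Rightarrow> real) \<Rightarrow> bool" where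
  "graph_ae_zero G l f \<longleftrightarrow> (\<forall>e\<in>arcs G. AE x in lebesgue_on {0<..<l e}. f e x = 0)"

definition L2_interval :: "real \<Rightarrow> (real \<Rightarrow> real) set" where
  "L2_interval a = {f \<in> borel_measurable (lebesgue_on {0<..<a}).
                      integrable (lebesgue_on {0<..<a}) (\<lambda>x. (f x)\<^sup>2)}"

definition RL_integral :: "real \<Rightarrow> (real \<Rightarrow> real) \<Rightarrow> real \<Rightarrow> real" where
  "RL_integral \<alpha> y x =
     1 / Gamma \<alpha> * (LINT \<xi>|lebesgue_on {0<..<x}. y \<xi> / (x - \<xi>) powr (1 - \<alpha>))"

definition RL_deriv :: "real \<Rightarrow> (real \<Rightarrow> real) \<Rightarrow> real \<Rightarrow> real" where
  "RL_deriv \<beta> y = deriv (RL_integral (1 - \<beta>) y)"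

definition AC_frac :: "real \<Rightarrow> real \<Rightarrow> (real \<Rightarrow> real) set" where
  "AC_frac \<beta> a = {f. \<exists>c0. \<exists>\<phi>\<in>L2_interval a. AE x in lebesgue_on {0<..<a}.
                     f x = c0 / Gamma \<beta> * x powr (\<beta> - 1) + RL_integral \<beta> \<phi> x}"

definition H_plus :: "real \<Rightarrow> real \<Rightarrow> (real \<Rightarrow> real) set" where
  "H_plus \<beta> a = AC_frac \<beta> a \<inter> L2_interval a"

text \<open>
  For f in H_plus \<beta> a with 1/2 < \<beta> < 1, the integral defining RL_integral (1 - \<beta>) f x exists for
  every 0 < x < a and depends continuously on x, so on the open interval it is itself the continuous
  representative of the fractional integral.  Only its values at the end points have to be taken as
  limits (the formula yields 0 at x = 0), which is what has_vertex_value does.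
\<close>

definition H_graph ::
    "('v, 'e) pre_digraph \<Rightarrow> ('e \<Rightarrow> real) \<Rightarrow> real \<Rightarrow> ('e \<Rightarrow> real \<Rightarrow> real) set" where
  "H_graph G l \<beta> = {u. (\<forall>e\<in>arcs G. u e \<in> H_plus \<beta> (l e)) \<and>
                       continuous_on_graph G l (\<lambda>e. RL_integral (1 - \<beta>) (u e))}"

definition H_graph_Dir ::
    "('v, 'e) pre_digraph \<Rightarrow> ('e \<Rightarrow> real) \<Rightarrow> real \<Rightarrow> ('e \<Rightarrow> real \<Rightarrow> real) set" where
  "H_graph_Dir G l \<beta> = {u \<in> H_graph G l \<beta>. \<forall>v\<in>boundary_verts G.
                           has_vertex_value G l (\<lambda>e. RL_integral (1 - \<beta>) (u e)) v 0}"

definition generalized_solution ::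
    "('v, 'e) pre_digraph \<Rightarrow> ('e \<Rightarrow> real) \<Rightarrow> real \<Rightarrow> ('e \<Rightarrow> real \<Rightarrow> real) \<Rightarrow> ('e \<Rightarrow> real \<Rightarrow> real) \<Rightarrow>
     real \<Rightarrow> ('e \<Rightarrow> real \<Rightarrow> real) \<Rightarrow> bool" where
  "generalized_solution G l \<beta> p r \<mu> u \<longleftrightarrow> u \<in> H_graph_Dir G l \<beta> \<and>
     (\<forall>w\<in>H_graph_Dir G l \<beta>.
        graph_inner G l (\<lambda>e x. p e x * RL_deriv \<beta> (u e) x) (\<lambda>e. RL_deriv \<beta> (w e)) =
        \<mu> * graph_inner G l (\<lambda>e x. r e x * u e x) w)"

definition eigenfunction ::
    "('v, 'e) pre_digraph \<Rightarrow> ('e \<Rightarrow> real) \<Rightarrow> real \<Rightarrow> ('e \<Rightarrow> real \<Rightarrow> real) \<Rightarrow> ('e \<Rightarrow> real \<Rightarrow> real) \<Rightarrow>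
     real \<Rightarrow> ('e \<Rightarrow> real \<Rightarrow> real) \<Rightarrow> bool" where
  "eigenfunction G l \<beta> p r \<mu> u \<longleftrightarrow> generalized_solution G l \<beta> p r \<mu> u \<and> \<not> graph_ae_zero G l u"

text \<open>
  The space of generalized solutions for \<mu>, modulo equality almost everywhere, has a basis of m
  elements.  Thus m = 0 means that \<mu> is not an eigenvalue, and otherwise m is its multiplicity.
\<close>

definition has_multiplicity ::
    "('v, 'e) pre_digraph \<Rightarrow> ('e \<Rightarrow> real) \<Rightarrow> real \<Rightarrow> ('e \<Rightarrow> real \<Rightarrow> real) \<Rightarrow> ('e \<Rightarrow> real \<Rightarrow> real) \<Rightarrow>
     real \<Rightarrow> nat \<Rightarrow> bool" where
  "has_multiplicity G l \<beta> p r \<mu> m \<longleftrightarrow>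
     (\<exists>b. (\<forall>i<m. generalized_solution G l \<beta> p r \<mu> (b i)) \<and>
          (\<forall>c. graph_ae_zero G l (\<lambda>e x. \<Sum>i<m. c i * b i e x) \<longrightarrow> (\<forall>i<m. c i = 0)) \<and>
          (\<forall>v. generalized_solution G l \<beta> p r \<mu> v \<longrightarrow>
               (\<exists>c. graph_ae_zero G l (\<lambda>e x. v e x - (\<Sum>i<m. c i * b i e x)))))"

definition enumerates_eigenvalues ::
    "('v, 'e) pre_digraph \<Rightarrow> ('e \<Rightarrow> real) \<Rightarrow> real \<Rightarrow> ('e \<Rightarrow> real \<Rightarrow> real) \<Rightarrow> ('e \<Rightarrow> real \<Rightarrow> real) \<Rightarrow>
     (nat \<Rightarrow> real) \<Rightarrow> bool" where
  "enumerates_eigenvalues G l \<beta> p r lam \<longleftrightarrow> incseq lam \<and>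
     (\<forall>\<mu>. finite {k. lam k = \<mu>} \<and> has_multiplicity G l \<beta> p r \<mu> (card {k. lam k = \<mu>}))"

definition weighted_orthonormal ::
    "('v, 'e) pre_digraph \<Rightarrow> ('e \<Rightarrow> real) \<Rightarrow> ('e \<Rightarrow> real \<Rightarrow> real) \<Rightarrow> (nat \<Rightarrow> 'e \<Rightarrow> real \<Rightarrow> real) \<Rightarrow> bool" where
  "weighted_orthonormal G l r u \<longleftrightarrow>
     (\<forall>j k. graph_inner G l (\<lambda>e x. r e x * u j e x) (u k) = (if j = k then 1 else 0))"

end

theory Submission
  imports Defs
begin

text \<open>
  Write \<psi>_k for the fractional derivative of u_k.  Taking the eigenfunctions themselves as test functions
  shows that the \<psi>_k are orthogonal in the p-weighted inner product, with squared norms \<lambda>_k, while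
  the u_k are orthonormal in the r-weighted one.  Bessel's inequality therefore holds for both systems
  (\<open>bessel_inequality_edge\<close>).  With the factors d_k = 1 / (1 + \<lambda>_k), for which both d_k \<le> 1 and
  d_k \<lambda>_k \<le> 1, it reads: on every edge, for each square integrable h, both \<Sum> d_k (\<integral> h u_k)^2 and
  \<Sum> d_k (\<integral> h \<psi>_k)^2 are bounded by a multiple of \<integral> h^2 that does not depend on the eigenfunctions.

  On an edge, u_k is almost everywhere the sum of a singular part, namely c_k x powr (\<beta> - 1) / \<Gamma>(\<beta>), and
  of the fractional integral of \<psi>_k, and its fractional integral of order 1 - \<beta> at x is
  c_k + \<integral> \<psi>_k over (0, x) (\<open>H_plus_representation\<close>).  Since \<beta> > 1/2, the value of the fractional integral
  at x is the inner product of \<psi>_k with a kernel whose L2 norm is bounded uniformly in x.  So Bessel's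
  inequality bounds \<Sum> d_k (fractional integral of \<psi>_k at x)^2 uniformly in x (\<open>sum_regular_part\<close>).
  Integrating the decomposition of u_k over the edge expresses c_k by \<integral> u_k and the integral of the regular
  part, so \<Sum> d_k c_k^2 is bounded as well (\<open>sum_coef\<close>).

  Both claims follow.  A single term of these sums gives |c_k| and |\<integral> \<psi>_k| at most a constant times
  sqrt (1 + \<lambda>_k), which is the pointwise bound.  For the series,
  \<Sum> d_k = \<Sum> d_k \<integral> r u_k^2 \<le> R1 \<integral> \<Sum> d_k u_k^2, and the last integrand is dominated by a multiple of
  x powr (2 \<beta> - 2) plus a constant, which is integrable because \<beta> > 1/2.  Thus \<Sum> 1 / (1 + \<lambda>_k) converges,
  and with it \<Sum> 1 / \<lambda>_k.  The estimates are made edge by edge; at a vertex the bound is inherited from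
  an incident edge, and connectedness together with a boundary vertex guarantees that there is one
  (\<open>incident_arc_exists\<close>).  At an isolated vertex every real number would be a vertex value.
\<close>

section \<open>Square integrable functions\<close>

definition square_integrable :: "'a measure \<Rightarrow> ('a \<Rightarrow> real) \<Rightarrow> bool" where
  "square_integrable M f \<longleftrightarrow> f \<in> borel_measurable M \<and> integrable M (\<lambda>x. (f x)\<^sup>2)"

lemma L2_interval_iff: "f \<in> L2_interval a \<longleftrightarrow> square_integrable (lebesgue_on {0<..<a}) f"
  by (simp add: L2_interval_def square_integrable_def)

lemma square_integrable_mult:
  assumes "square_integrable M f" "square_integrable M g"
  shows "integrable M (\<lambda>x. f x * g x)"
proof (rule Bochner_Integration.integrable_bound)
  show "integrable M (\<lambda>x. (f x)\<^sup>2 + (g x)\<^sup>2)"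
    using assms by (auto simp: square_integrable_def)
  show "(\<lambda>x. f x * g x) \<in> borel_measurable M"
    using assms by (auto simp: square_integrable_def)
  have "\<bar>a * b\<bar> \<le> a\<^sup>2 + b\<^sup>2" for a b :: real
  proof -
    have "0 \<le> (\<bar>a\<bar> - \<bar>b\<bar>)\<^sup>2" by simp
    then have "2 * (\<bar>a\<bar> * \<bar>b\<bar>) \<le> a\<^sup>2 + b\<^sup>2"
      unfolding power2_diff by simp
    moreover have "0 \<le> \<bar>a\<bar> * \<bar>b\<bar>" by simp
    ultimately show ?thesis unfolding abs_mult by linarith
  qed
  then show "AE x in M. norm (f x * g x) \<le> norm ((f x)\<^sup>2 + (g x)\<^sup>2)"
    by (auto intro!: AE_I2)
qed

lemma square_integrable_scale:
  "square_integrable M f \<Longrightarrow> square_integrable M (\<lambda>x. c * f x)"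
  by (auto simp: square_integrable_def power_mult_distrib)

lemma square_integrable_add:
  assumes "square_integrable M f" "square_integrable M g"
  shows "square_integrable M (\<lambda>x. f x + g x)"
proof -
  have "integrable M (\<lambda>x. (f x)\<^sup>2 + (g x)\<^sup>2 + 2 * (f x * g x))"
    using assms square_integrable_mult[OF assms] by (auto simp: square_integrable_def)
  then show ?thesis
    using assms by (auto simp: square_integrable_def power2_sum mult.assoc)
qed

lemma square_integrable_sum:
  assumes "\<And>i. i \<in> S \<Longrightarrow> square_integrable M (f i)"
  shows "square_integrable M (\<lambda>x. \<Sum>i\<in>S. f i x)"
  using assms
proof (induction S rule: infinite_finite_induct)
  case (insert i S)
  then show ?case using square_integrable_add[of M "f i" "\<lambda>x. \<Sum>i\<in>S. f i x"] by simp
qed (auto simp: square_integrable_def)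

lemma square_integrable_bounded_mult:
  assumes "square_integrable M f" "q \<in> borel_measurable M" "\<And>x. x \<in> space M \<Longrightarrow> \<bar>q x\<bar> \<le> B"
  shows "square_integrable M (\<lambda>x. q x * f x)"
  unfolding square_integrable_def
proof
  show "(\<lambda>x. q x * f x) \<in> borel_measurable M"
    using assms by (auto simp: square_integrable_def)
  show "integrable M (\<lambda>x. (q x * f x)\<^sup>2)"
  proof (rule Bochner_Integration.integrable_bound)
    show "integrable M (\<lambda>x. B\<^sup>2 * (f x)\<^sup>2)"
      using assms by (auto simp: square_integrable_def)
    show "(\<lambda>x. (q x * f x)\<^sup>2) \<in> borel_measurable M"
      using assms by (auto simp: square_integrable_def)
    show "AE x in M. norm ((q x * f x)\<^sup>2) \<le> norm (B\<^sup>2 * (f x)\<^sup>2)"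
    proof (rule AE_I2)
      fix x assume "x \<in> space M"
      then have "(q x)\<^sup>2 \<le> B\<^sup>2"
        using assms(3)[of x] by (metis abs_ge_zero power2_abs power_mono)
      then show "norm ((q x * f x)\<^sup>2) \<le> norm (B\<^sup>2 * (f x)\<^sup>2)"
        by (simp add: power_mult_distrib mult_right_mono)
    qed
  qed
qed

lemma square_integrable_cong_AE:
  assumes "square_integrable M f" "g \<in> borel_measurable M" "AE x in M. f x = g x"
  shows "square_integrable M g"
proof -
  have "integrable M (\<lambda>x. (f x)\<^sup>2) \<longleftrightarrow> integrable M (\<lambda>x. (g x)\<^sup>2)"
    using assms by (intro integrable_cong_AE) (auto simp: square_integrable_def)
  then show ?thesis using assms by (auto simp: square_integrable_def)
qed

lemma AE_lebesgue_on_interval: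
  "(AE t in lebesgue_on {0<..<a::real}. P t) \<longleftrightarrow> (AE t in lebesgue. 0 < t \<and> t < a \<longrightarrow> P t)"
  by (simp add: AE_restrict_space_iff)

lemma AE_lebesgue_on_initial:
  assumes "AE t in lebesgue_on {0<..<a::real}. P t" "x \<le> a"
  shows "AE t in lebesgue_on {0<..<x}. P t"
  using assms(1) unfolding AE_lebesgue_on_interval by eventually_elim (use assms(2) in auto)

lemma borel_measurable_lebesgue_on_AE:
  fixes f g :: "real \<Rightarrow> real"
  assumes f: "f \<in> borel_measurable (lebesgue_on S)" and S: "S \<in> sets lebesgue"
    and fg: "AE x in lebesgue_on S. f x = g x"
  shows "g \<in> borel_measurable (lebesgue_on S)"
proof -
  have "(\<lambda>x. if x \<in> S then f x else 0) \<in> borel_measurable lebesgue"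
    using f S by (simp add: borel_measurable_if)
  moreover have "AE x in lebesgue. (if x \<in> S then f x else 0) = (if x \<in> S then g x else 0)"
    using fg S by (auto simp: AE_restrict_space_iff elim!: eventually_mono)
  ultimately have "(\<lambda>x. if x \<in> S then g x else 0) \<in> borel_measurable lebesgue"
    by (rule borel_measurable_AE)
  then show ?thesis
    using S by (simp add: borel_measurable_if)
qed

lemma square_integrable_const_interval: "square_integrable (lebesgue_on {0<..<a::real}) (\<lambda>x. c)"
proof -
  interpret finite_measure "lebesgue_on {0<..<a}"
    by (rule finite_measure_lebesgue_on) simp
  show ?thesis by (simp add: square_integrable_def)
qed

lemma square_integrable_imp_integrable_interval:
  "square_integrable (lebesgue_on {0<..<a::real}) f \<Longrightarrow> integrable (lebesgue_on {0<..<a}) f"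
  using square_integrable_mult[OF _ square_integrable_const_interval[of a 1]] by simp

lemma powr_has_integral_from_0:
  fixes a s :: real
  assumes "s > -1" "a \<ge> 0"
  shows "integrable (lebesgue_on {0<..<a}) (\<lambda>x. x powr s)"
    and "(LINT x|lebesgue_on {0<..<a}. x powr s) = a powr (s + 1) / (s + 1)"
proof -
  have i: "((\<lambda>x. x powr s) has_integral a powr (s + 1) / (s + 1)) {0<..<a}"
    using has_integral_powr_from_0[of s a] assms by (simp add: has_integral_Icc_iff_Ioo)
  then have "(\<lambda>x. x powr s) absolutely_integrable_on {0<..<a}"
    by (intro nonnegative_absolutely_integrable_1) auto
  then show ii: "integrable (lebesgue_on {0<..<a}) (\<lambda>x. x powr s)"
    by (rule absolutely_integrable_imp_integrable) simp
  show "(LINT x|lebesgue_on {0<..<a}. x powr s) = a powr (s + 1) / (s + 1)"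
    using lebesgue_integral_eq_integral[OF ii] i by (simp add: integral_unique)
qed

text \<open>
  The Cauchy--Schwarz inequality against the constant 1, read off from the nonnegative variance of f.
\<close>

lemma square_integral_interval_le:
  fixes f :: "real \<Rightarrow> real"
  assumes f: "square_integrable (lebesgue_on {0<..<a}) f" and a: "0 < a"
  shows "(LINT x|lebesgue_on {0<..<a}. f x)\<^sup>2 \<le> a * (LINT x|lebesgue_on {0<..<a}. (f x)\<^sup>2)"
proof -
  let ?M = "lebesgue_on {0<..<a}"
  \<comment> \<open>the mean value of f\<close>
  define m where "m = (LINT x|?M. f x) / a"
  have one: "integrable ?M (\<lambda>x. m\<^sup>2)"
    using square_integrable_const_interval by (rule square_integrable_imp_integrable_interval)
  have mass: "(LINT x|?M. m\<^sup>2) = a * m\<^sup>2"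
    using a by (simp add: measure_restrict_space)
  have fi: "integrable ?M f" "integrable ?M (\<lambda>x. (f x)\<^sup>2)"
    using square_integrable_imp_integrable_interval[OF f] f by (simp_all add: square_integrable_def)
  have mf: "integrable ?M (\<lambda>x. 2 * m * f x)"
    using fi(1) by (intro integrable_mult_right)
  have "0 \<le> (LINT x|?M. (f x - m)\<^sup>2)"
    by (intro integral_nonneg_AE AE_I2) simp
  also have "(\<lambda>x. (f x - m)\<^sup>2) = (\<lambda>x. (f x)\<^sup>2 + m\<^sup>2 - 2 * m * f x)"
    by (rule ext) (simp only: power2_diff mult_ac)
  also have "(LINT x|?M. (f x)\<^sup>2 + m\<^sup>2 - 2 * m * f x) = (LINT x|?M. (f x)\<^sup>2) + a * m\<^sup>2 - 2 * m * (LINT x|?M. f x)"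
    unfolding Bochner_Integration.integral_diff[OF Bochner_Integration.integrable_add[OF fi(2) one] mf]
      Bochner_Integration.integral_add[OF fi(2) one] mass integral_mult_right_zero ..
  also have "(LINT x|?M. f x) = a * m" using a by (simp add: m_def)
  finally have "a * (a * m\<^sup>2) \<le> a * (LINT x|?M. (f x)\<^sup>2)"
    using a by (intro mult_left_mono) (simp_all add: power2_eq_square)
  then show ?thesis
    using a by (simp add: m_def power2_eq_square)
qed

section \<open>Bessel's inequality on a graph\<close>

text \<open>
  Bessel's inequality for a family that is orthogonal over all edges together, tested against a function
  on one edge e0.  With b_k = \<integral> h f_k and s = \<Sum> d_k b_k f_k, orthogonality and d_k c_k \<le> 1 bound the weighted
  energy of s by B = \<Sum> d_k b_k^2, while B = \<integral> h s.  The arithmetic-geometric mean inequality then gives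
  2 B \<le> \<integral> h^2 / q0 + B.  Free factors d_k, instead of 1 / c_k, allow vanishing norms c_k.
\<close>

lemma bessel_inequality_edge:
  fixes M :: "'e \<Rightarrow> 'a measure" and f :: "'k \<Rightarrow> 'e \<Rightarrow> 'a \<Rightarrow> real"
  assumes fin: "finite A" "e0 \<in> A" "finite S"
    and q: "\<And>e. e \<in> A \<Longrightarrow> q e \<in> borel_measurable (M e)"
      "\<And>e x. e \<in> A \<Longrightarrow> x \<in> space (M e) \<Longrightarrow> q0 \<le> q e x"
      "\<And>e x. e \<in> A \<Longrightarrow> x \<in> space (M e) \<Longrightarrow> q e x \<le> q1" and q0: "0 < q0"
    and f: "\<And>k e. k \<in> S \<Longrightarrow> e \<in> A \<Longrightarrow> square_integrable (M e) (f k e)"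
    and orth: "\<And>j k. j \<in> S \<Longrightarrow> k \<in> S \<Longrightarrow>
      (\<Sum>e\<in>A. LINT x|M e. q e x * f j e x * f k e x) = (if j = k then c k else 0)"
    and d: "\<And>k. k \<in> S \<Longrightarrow> 0 \<le> d k" "\<And>k. k \<in> S \<Longrightarrow> d k * c k \<le> 1"
    and h: "square_integrable (M e0) h"
  shows "(\<Sum>k\<in>S. d k * (LINT x|M e0. h x * f k e0 x)\<^sup>2) \<le> (LINT x|M e0. (h x)\<^sup>2) / q0"
proof -
  define b where "b k = (LINT x|M e0. h x * f k e0 x)" for k
  define s where "s e x = (\<Sum>k\<in>S. d k * b k * f k e x)" for e x
  define B where "B = (\<Sum>k\<in>S. d k * (b k)\<^sup>2)"
  have s: "square_integrable (M e) (s e)" if "e \<in> A" for e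
    unfolding s_def using that by (intro square_integrable_sum square_integrable_scale f)
  have qi: "square_integrable (M e) (\<lambda>x. q e x * g x)"
    if "e \<in> A" "square_integrable (M e) g" for e g
    using that q q0 by (intro square_integrable_bounded_mult[where B = q1]) (auto, force)
  have qss: "integrable (M e) (\<lambda>x. q e x * (s e x)\<^sup>2)" if "e \<in> A" for e
    using square_integrable_mult[OF qi[OF that s[OF that]] s[OF that]]
    by (simp add: power2_eq_square mult.assoc)
  have Bs: "B = (LINT x|M e0. h x * s e0 x)"
  proof -
    have "(LINT x|M e0. h x * s e0 x) = (LINT x|M e0. (\<Sum>k\<in>S. d k * b k * (h x * f k e0 x)))"
      unfolding s_def by (simp add: sum_distrib_left mult_ac)
    also have "\<dots> = (\<Sum>k\<in>S. d k * b k * b k)"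
      unfolding b_def using fin h f
      by (subst Bochner_Integration.integral_sum)
        (auto intro!: integrable_mult_right square_integrable_mult)
    finally show ?thesis by (simp add: B_def power2_eq_square mult.assoc)
  qed
  have energy: "(\<Sum>e\<in>A. LINT x|M e. q e x * (s e x)\<^sup>2) \<le> B"
  proof -
    have "(LINT x|M e. q e x * (s e x)\<^sup>2) =
        (\<Sum>j\<in>S. \<Sum>k\<in>S. d j * b j * (d k * b k) * (LINT x|M e. q e x * f j e x * f k e x))"
      if e: "e \<in> A" for e
    proof -
      have i: "integrable (M e) (\<lambda>x. q e x * f j e x * f k e x)" if "j \<in> S" "k \<in> S" for j k
        using that e f qi by (intro square_integrable_mult) auto
      have "q e x * (s e x)\<^sup>2 =
          (\<Sum>j\<in>S. \<Sum>k\<in>S. d j * b j * (d k * b k) * (q e x * f j e x * f k e x))" for x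
        unfolding s_def power2_eq_square sum_product
        unfolding sum_distrib_left by (intro sum.cong refl) (simp only: mult_ac)
      then show ?thesis
        using i by (simp add: Bochner_Integration.integral_sum Bochner_Integration.integrable_sum)
    qed
    then have "(\<Sum>e\<in>A. LINT x|M e. q e x * (s e x)\<^sup>2) =
        (\<Sum>e\<in>A. \<Sum>j\<in>S. \<Sum>k\<in>S. d j * b j * (d k * b k) * (LINT x|M e. q e x * f j e x * f k e x))"
      by simp
    also have "\<dots> = (\<Sum>j\<in>S. \<Sum>k\<in>S. d j * b j * (d k * b k) *
        (\<Sum>e\<in>A. LINT x|M e. q e x * f j e x * f k e x))"
      unfolding sum_distrib_left
      by (subst sum.swap, rule sum.cong[OF refl], subst sum.swap, rule refl)
    also have "\<dots> = (\<Sum>j\<in>S. \<Sum>k\<in>S. if j = k then d j * b j * (d k * b k) * c k else 0)"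
      using orth by (intro sum.cong refl) auto
    also have "\<dots> = (\<Sum>j\<in>S. d j * b j * (d j * b j) * c j)"
      using fin by simp
    also have "\<dots> \<le> B"
      unfolding B_def
    proof (rule sum_mono)
      fix k assume "k \<in> S"
      then have "(d k * c k) * (d k * (b k)\<^sup>2) \<le> 1 * (d k * (b k)\<^sup>2)"
        using d by (intro mult_right_mono) auto
      then show "d k * b k * (d k * b k) * c k \<le> d k * (b k)\<^sup>2"
        by (simp add: power2_eq_square mult_ac)
    qed
    finally show ?thesis .
  qed
  \<comment> \<open>completing the square with the lower bound q0 of the weight\<close>
  have amgm: "2 * (a * t) \<le> a\<^sup>2 / q0 + w * t\<^sup>2" if "q0 \<le> w" for a t w :: real
  proof -
    have "0 \<le> (a - q0 * t)\<^sup>2 / q0" using q0 by simp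
    also have "\<dots> = a\<^sup>2 / q0 - 2 * (a * t) + q0 * t\<^sup>2"
      using q0 by (simp add: field_simps power2_eq_square)
    also have "\<dots> \<le> a\<^sup>2 / q0 - 2 * (a * t) + w * t\<^sup>2"
      using that by (simp add: mult_right_mono)
    finally show ?thesis by simp
  qed
  have "2 * B = (LINT x|M e0. 2 * (h x * s e0 x))"
    using Bs by simp
  also have "\<dots> \<le> (LINT x|M e0. (h x)\<^sup>2 / q0 + q e0 x * (s e0 x)\<^sup>2)"
  proof (rule integral_mono)
    show "integrable (M e0) (\<lambda>x. 2 * (h x * s e0 x))"
      using square_integrable_mult[OF h s[OF fin(2)]] by simp
    show "integrable (M e0) (\<lambda>x. (h x)\<^sup>2 / q0 + q e0 x * (s e0 x)\<^sup>2)"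
      using h qss[OF fin(2)] by (simp add: square_integrable_def)
  qed (use amgm q fin in auto)
  also have "\<dots> = (LINT x|M e0. (h x)\<^sup>2) / q0 + (LINT x|M e0. q e0 x * (s e0 x)\<^sup>2)"
    using h qss fin by (subst Bochner_Integration.integral_add) (auto simp: square_integrable_def)
  also have "(LINT x|M e0. q e0 x * (s e0 x)\<^sup>2) \<le> (\<Sum>e\<in>A. LINT x|M e. q e x * (s e x)\<^sup>2)"
  proof (rule member_le_sum)
    show "0 \<le> (LINT x|M e. q e x * (s e x)\<^sup>2)" if "e \<in> A - {e0}" for e
      using that q(2)[of e] q0 by (intro integral_nonneg_AE AE_I2) force
  qed (use fin in auto)
  also note energy
  finally show ?thesis by (simp add: B_def b_def)
qed

section \<open>Differentiation of indefinite integrals\<close>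

text \<open>
  Lebesgue's differentiation theorem on the line.  The averages of f over [x, x + h] converge to f x for
  almost every x, which is the statement about right-hand difference quotients; applied to the reflected
  function t \<mapsto> f (- t) it also yields the left-hand ones.
\<close>

lemma AE_deriv_lebesgue_integral:
  fixes f :: "real \<Rightarrow> real"
  assumes f: "integrable (lebesgue_on {0<..<a}) f"
  shows "AE x in lebesgue_on {0<..<a}.
    ((\<lambda>x. LINT t|lebesgue_on {0<..<x}. f t) has_real_derivative f x) (at x)"
proof -
  define g where "g x = (if x \<in> {0<..<a} then f x else 0)" for x
  have gL: "integrable lebesgue g"
    using f unfolding g_def by (intro Lebesgue_Measure.integrable_restrict_UNIV[THEN iffD2]) simp_all
  have gi: "g integrable_on S" if "S \<in> sets lebesgue" for S
    using integrable_mult_indicator[OF that gL] that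
    by (intro integrable_on_lebesgue_on) (simp_all add: integrable_restrict_space)
  define F where "F x = integral {0..x} g" for x
  have Feq: "(LINT t|lebesgue_on {0<..<x}. f t) = F x" if "x \<in> {0<..<a}" for x
  proof -
    have "(LINT t|lebesgue_on {0<..<x}. f t) = (LINT t|lebesgue_on {0<..<x}. g t)"
      using that by (intro Bochner_Integration.integral_cong) (auto simp: g_def)
    also have "\<dots> = integral {0<..<x} g"
      using integrable_mult_indicator[OF _ gL, of "{0<..<x}"]
      by (intro lebesgue_integral_eq_integral) (simp_all add: integrable_restrict_space)
    also have "\<dots> = F x"
      unfolding F_def by (simp add: integral_open_interval_real)
    finally show ?thesis .
  qed
  have Fdiff: "integral {x..y} g = F y - F x" if "0 \<le> x" "x \<le> y" for x y
    unfolding F_def using Henstock_Kurzweil_Integration.integral_combine[where f = g and a = 0 and c = x and b = y] that gi by auto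
  obtain N where N: "negligible N" and
    Nlim: "\<And>x e. x \<notin> N \<Longrightarrow> 0 < e \<Longrightarrow>
      \<exists>d>0. \<forall>h. 0 < h \<and> h < d \<longrightarrow> norm (integral {x..x + h} g /\<^sub>R h - g x) < e"
    using integrable_ccontinuous_explicit[of g] gi by (auto simp: cbox_interval)
  have refl_i: "(\<lambda>x. g (- x)) integrable_on cbox u v" for u v :: real
    using gi[of "{-v..-u}"] Henstock_Kurzweil_Integration.integrable_reflect_real[where f = g and a = "-v" and b = "-u"] by simp
  \<comment> \<open>the reflected function controls the averages over [x - h, x] for x outside the reflected null set\<close>
  obtain N' where N': "negligible N'" and
    N'lim: "\<And>x e. x \<notin> N' \<Longrightarrow> 0 < e \<Longrightarrow>
      \<exists>d>0. \<forall>h. 0 < h \<and> h < d \<longrightarrow> norm (integral {x..x + h} (\<lambda>x. g (- x)) /\<^sub>R h - g (- x)) < e"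
    using integrable_ccontinuous_explicit[of "\<lambda>x. g (- x)"] refl_i by (auto simp: cbox_interval)
  have neg: "negligible (uminus ` N')"
    by (intro negligible_differentiable_image_negligible N')
       (auto intro!: derivative_intros simp: differentiable_on_def)
  have deriv: "((\<lambda>x. LINT t|lebesgue_on {0<..<x}. f t) has_real_derivative f x) (at x)"
    if x: "x \<in> {0<..<a}" "x \<notin> N" "x \<notin> uminus ` N'" for x
  proof -
    have gx: "g x = f x" using x by (simp add: g_def)
    have "(F has_real_derivative g x) (at x)"
      unfolding has_field_derivative_iff tendsto_iff eventually_at
    proof (intro allI impI)
      fix e :: real assume e: "0 < e"
      have "- x \<notin> N'" using x(3) by (metis image_eqI minus_minus)
      from N'lim[OF this e] obtain d' where d': "d' > 0"
        "\<And>h. 0 < h \<Longrightarrow> h < d' \<Longrightarrow> \<bar>integral {- x..- x + h} (\<lambda>x. g (- x)) /\<^sub>R h - g x\<bar> < e"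
        by auto
      from Nlim[OF x(2) e] obtain d where d: "d > 0"
        "\<And>h. 0 < h \<Longrightarrow> h < d \<Longrightarrow> \<bar>integral {x..x + h} g /\<^sub>R h - g x\<bar> < e"
        by auto
      have "dist ((F y - F x) / (y - x)) (g x) < e"
        if y: "y \<noteq> x" "dist y x < min x (min d d')" for y
      proof (cases "x < y")
        case True
        have "integral {x..x + (y - x)} g = F y - F x"
          using Fdiff[of x y] True x by simp
        then show ?thesis
          using d(2)[of "y - x"] True y by (simp add: dist_real_def divide_inverse_commute)
      next
        case False
        have "integral {- x..- x + (x - y)} (\<lambda>x. g (- x)) = integral {y..x} g"
          using Henstock_Kurzweil_Integration.integral_reflect_real[where f = g and a = y and b = x] by simp
        also have "\<dots> = F x - F y"
          using Fdiff[of y x] False x y by (auto simp: dist_real_def abs_if split: if_splits)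
        finally have "\<bar>(F x - F y) /\<^sub>R (x - y) - g x\<bar> < e"
          using d'(2)[of "x - y"] False y by (auto simp: dist_real_def)
        moreover have "(F x - F y) /\<^sub>R (x - y) = (F y - F x) / (y - x)"
          by (metis divide_inverse_commute minus_diff_eq minus_divide_divide real_scaleR_def)
        ultimately show ?thesis by (simp add: dist_real_def)
      qed
      then show "\<exists>d>0. \<forall>y\<in>UNIV. y \<noteq> x \<and> dist y x < d \<longrightarrow> dist ((F y - F x) / (y - x)) (g x) < e"
        using d d' x by (intro exI[of _ "min x (min d d')"]) auto
    qed
    moreover have "eventually (\<lambda>y. F y = (LINT t|lebesgue_on {0<..<y}. f t)) (nhds x)"
      using x by (intro eventually_nhds_in_open[THEN eventually_mono, of "{0<..<a}"]) (auto simp: Feq)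
    ultimately show ?thesis
      using Feq[OF x(1)] gx by (subst DERIV_cong_ev[OF refl _ refl, symmetric]) auto
  qed
  have "AE x in lebesgue. x \<notin> N \<and> x \<notin> uminus ` N'"
    using AE_not_in[of N lebesgue] AE_not_in[of "uminus ` N'" lebesgue] N neg
    by (auto simp: negligible_iff_null_sets)
  then show ?thesis
    unfolding AE_lebesgue_on_interval by eventually_elim (use deriv in auto)
qed

section \<open>Composition of fractional integrals\<close>

text \<open>
  The substitution \<xi> = t + (x - t) s turns this into the Beta integral B(\<beta>, 1 - \<beta>); the powers of x - t
  cancel against the Jacobian, so that the value depends neither on t nor on x.
\<close>

lemma nn_integral_abel_kernel:
  fixes \<beta> t x :: real
  assumes \<beta>: "0 < \<beta>" "\<beta> < 1" and "t < x"
  shows "(\<integral>\<^sup>+\<xi>. ennreal (if t < \<xi> \<and> \<xi> < x then (\<xi> - t) powr (\<beta> - 1) * (x - \<xi>) powr (- \<beta>) else 0) \<partial>lborel)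
    = ennreal (Gamma \<beta> * Gamma (1 - \<beta>))" (is "integral\<^sup>N lborel ?f = _")
proof -
  define L where "L = x - t"
  have L: "L > 0" using assms by (simp add: L_def)
  have "((\<lambda>s. s powr (\<beta> - 1) * (1 - s) powr (- \<beta>)) has_integral Gamma \<beta> * Gamma (1 - \<beta>)) {0<..<1}"
    using has_integral_Beta_real[of \<beta> "1 - \<beta>"] \<beta> by (simp add: has_integral_Icc_iff_Ioo Beta_def)
  then have beta: "(\<integral>\<^sup>+s. ennreal (s powr (\<beta> - 1) * (1 - s) powr (- \<beta>)) * indicator {0<..<1} s \<partial>lborel)
      = ennreal (Gamma \<beta> * Gamma (1 - \<beta>))"
    by (intro nn_integral_has_integral_lebesgue') auto
  have scale: "?f (t + L * s) = ennreal (1 / L) *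
      (ennreal (s powr (\<beta> - 1) * (1 - s) powr (- \<beta>)) * indicator {0<..<1} s)" for s
  proof (cases "0 < s \<and> s < 1")
    case True
    have rev: "x - (t + L * s) = L * (1 - s)" by (simp add: L_def algebra_simps)
    have "L * s < L * 1" using True L by (intro mult_strict_left_mono) auto
    then have lt: "t < t + L * s" "t + L * s < x" using True L L_def by (simp, linarith)
    have LL: "L powr (\<beta> - 1) * L powr (- \<beta>) = 1 / L"
      unfolding powr_add[symmetric] using L powr_minus_divide[of L 1] by simp
    have "(t + L * s - t) powr (\<beta> - 1) * (x - (t + L * s)) powr (- \<beta>)
        = (L powr (\<beta> - 1) * L powr (- \<beta>)) * (s powr (\<beta> - 1) * (1 - s) powr (- \<beta>))"
      unfolding rev using True L by (simp add: powr_mult)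
    then show ?thesis
      unfolding LL using lt True L by (simp add: ennreal_mult'[symmetric])
  next
    case False
    have "L * 1 \<le> L * s" if "1 \<le> s" using that L by (intro mult_left_mono) auto
    then have "\<not> (t < t + L * s \<and> t + L * s < x)"
      using False L L_def by (fastforce simp only: not_less mult_1_right zero_less_mult_iff less_add_same_cancel1)
    then show ?thesis using False by auto
  qed
  have "integral\<^sup>N lborel ?f = ennreal \<bar>L\<bar> * (\<integral>\<^sup>+s. ?f (t + L * s) \<partial>lborel)"
    using L by (intro nn_integral_real_affine) auto
  also have "(\<integral>\<^sup>+s. ?f (t + L * s) \<partial>lborel) = ennreal (1 / L) * ennreal (Gamma \<beta> * Gamma (1 - \<beta>))"
    unfolding scale by (subst nn_integral_cmult) (auto simp: beta)
  also have "ennreal \<bar>L\<bar> * \<dots> = ennreal (Gamma \<beta> * Gamma (1 - \<beta>))"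
    using L by (simp add: mult.assoc[symmetric] ennreal_mult'[symmetric])
  finally show ?thesis .
qed

lemma has_bochner_integral_abel_kernel:
  fixes \<beta> t x :: real
  assumes \<beta>: "0 < \<beta>" "\<beta> < 1" and "t < x"
  shows "has_bochner_integral lborel
    (\<lambda>\<xi>. if t < \<xi> \<and> \<xi> < x then (\<xi> - t) powr (\<beta> - 1) * (x - \<xi>) powr (- \<beta>) else 0)
    (Gamma \<beta> * Gamma (1 - \<beta>))"
  using nn_integral_abel_kernel[OF assms] \<beta>
  by (intro has_bochner_integral_nn_integral) (auto intro!: mult_nonneg_nonneg less_imp_le[OF Gamma_real_pos])

lemma integral_lebesgue_on_eq_lborel:
  fixes f :: "real \<Rightarrow> real"
  assumes "f \<in> borel_measurable borel" "S \<in> sets borel"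
  shows "(LINT x|lebesgue_on S. f x) = (LINT x|lborel. indicator S x * f x)"
  using assms by (simp add: integral_restrict_space integral_completion)

lemma RL_integral_cong_AE:
  assumes "AE t in lebesgue_on {0<..<a}. f t = g t"
    and "f \<in> borel_measurable (lebesgue_on {0<..<a})" "g \<in> borel_measurable (lebesgue_on {0<..<a})"
    and "x \<le> a"
  shows "RL_integral \<alpha> f x = RL_integral \<alpha> g x"
proof -
  have sub: "{0<..<x} \<subseteq> {0<..<a}" using assms(4) by auto
  have m: "f \<in> borel_measurable (lebesgue_on {0<..<x})" "g \<in> borel_measurable (lebesgue_on {0<..<x})"
    using assms measurable_restrict_mono[OF _ sub] by blast+
  have pm: "(\<lambda>\<xi>. (x - \<xi>) powr (1 - \<alpha>)) \<in> borel_measurable (lebesgue_on {0<..<x})"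
    by (intro measurable_restrict_space1 measurable_completion) auto
  have "AE t in lebesgue_on {0<..<x}. f t = g t"
    using AE_lebesgue_on_initial[OF assms(1,4)] .
  then show ?thesis
    unfolding RL_integral_def using m pm
    by (intro arg_cong2[where f = "(*)"] refl integral_cong_AE borel_measurable_divide) auto
qed

text \<open>
  Exchange the order of integration over 0 < t < \<xi> < x: the inner integral over \<xi> is the Abel kernel,
  which contributes the constant \<Gamma>(\<beta>) \<Gamma>(1 - \<beta>).  The exchange is carried out for a Borel representative
  g of \<phi>, since the product measure is formed from Borel measures.
\<close>

lemma RL_integral_semigroup:
  fixes \<phi> :: "real \<Rightarrow> real"
  assumes \<beta>: "0 < \<beta>" "\<beta> < 1" and \<phi>: "integrable (lebesgue_on {0<..<a}) \<phi>" and x: "0 < x" "x < a"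
  shows "integrable (lebesgue_on {0<..<x}) (\<lambda>\<xi>. RL_integral \<beta> \<phi> \<xi> / (x - \<xi>) powr \<beta>)"
    and "RL_integral (1 - \<beta>) (RL_integral \<beta> \<phi>) x = (LINT t|lebesgue_on {0<..<x}. \<phi> t)"
proof -
  have G: "Gamma \<beta> > 0" "Gamma (1 - \<beta>) > 0" using \<beta> by auto
  define \<phi>0 where "\<phi>0 t = (if t \<in> {0<..<a} then \<phi> t else 0)" for t
  have \<phi>0: "integrable lebesgue \<phi>0"
    using \<phi> unfolding \<phi>0_def by (intro Lebesgue_Measure.integrable_restrict_UNIV[THEN iffD2]) simp_all
  obtain g where g[measurable]: "g \<in> borel_measurable lborel" and g_eq: "AE t in lborel. \<phi>0 t = g t"
    using completion_ex_borel_measurable_real[of \<phi>0 lborel] \<phi>0 by auto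
  have gL: "AE t in lebesgue. \<phi>0 t = g t" using g_eq by (rule AE_completion)
  have gi: "integrable lborel g"
    using \<phi>0 gL integrable_cong_AE[of \<phi>0 lebesgue g] integrable_completion[of g lborel]
    by (auto simp: measurable_completion)
  have g_ae: "AE t in lebesgue_on {0<..<a}. \<phi> t = g t"
    unfolding AE_lebesgue_on_interval using gL by eventually_elim (auto simp: \<phi>0_def)
  have gm: "g \<in> borel_measurable (lebesgue_on S)" for S
    using g by (intro measurable_restrict_space1 measurable_completion)
  have \<phi>m: "\<phi> \<in> borel_measurable (lebesgue_on {0<..<a})" using \<phi> by auto
  \<comment> \<open>the Abel kernel, and the integrand on the triangle 0 < t < \<xi> < x extended by 0 to the plane\<close>
  define k where "k t \<xi> = (if t < \<xi> \<and> \<xi> < x then (\<xi> - t) powr (\<beta> - 1) * (x - \<xi>) powr (- \<beta>) else 0)" for t \<xi>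
  define K where "K t \<xi> = (indicator {0<..<x} t * g t) * k t \<xi>" for t \<xi>
  have k_int: "has_bochner_integral lborel (k t) (Gamma \<beta> * Gamma (1 - \<beta>))" if "t < x" for t
    unfolding k_def using has_bochner_integral_abel_kernel[OF \<beta> that] .
  have k0: "k t \<xi> \<ge> 0" for t \<xi> by (simp add: k_def)
  have K_int: "has_bochner_integral lborel (K t) (indicator {0<..<x} t * g t * (Gamma \<beta> * Gamma (1 - \<beta>)))" for t
  proof (cases "t < x")
    case True
    then show ?thesis unfolding K_def by (intro has_bochner_integral_mult_right k_int)
  next
    case False
    then have "K t = (\<lambda>\<xi>. 0)" by (auto simp: K_def)
    then show ?thesis using False has_bochner_integral_zero by simp
  qed
  have K_nint: "has_bochner_integral lborel (\<lambda>\<xi>. norm (K t \<xi>))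
      (\<bar>indicator {0<..<x} t * g t\<bar> * (Gamma \<beta> * Gamma (1 - \<beta>)))" for t
  proof (cases "t < x")
    case True
    have "norm (K t \<xi>) = \<bar>indicator {0<..<x} t * g t\<bar> * k t \<xi>" for \<xi>
      unfolding K_def using k0 by (simp add: abs_mult)
    then show ?thesis using True by (simp only:) (intro has_bochner_integral_mult_right k_int)
  next
    case False
    then have "K t = (\<lambda>\<xi>. 0)" by (auto simp: K_def)
    then show ?thesis using False has_bochner_integral_zero by simp
  qed
  have Km: "case_prod K \<in> borel_measurable (lborel \<Otimes>\<^sub>M lborel)"
    unfolding K_def k_def by measurable
  have gix: "integrable lborel (\<lambda>t. indicator {0<..<x} t * g t)"
    using gi integrable_mult_indicator[of "{0<..<x}" lborel g] by simp
  have Kpair: "integrable (lborel \<Otimes>\<^sub>M lborel) (case_prod K)"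
  proof (rule lborel_pair.Fubini_integrable[OF Km])
    have "(\<lambda>t. LINT \<xi>|lborel. norm (case (t, \<xi>) of (t, \<xi>) \<Rightarrow> K t \<xi>)) =
        (\<lambda>t. \<bar>indicator {0<..<x} t * g t\<bar> * (Gamma \<beta> * Gamma (1 - \<beta>)))"
      using has_bochner_integral_integral_eq[OF K_nint] by auto
    then show "integrable lborel (\<lambda>t. LINT \<xi>|lborel. norm (case (t, \<xi>) of (t, \<xi>) \<Rightarrow> K t \<xi>))"
      using gix by (simp only:) (intro integrable_mult_left integrable_abs)
    show "AE t in lborel. integrable lborel (\<lambda>\<xi>. case (t, \<xi>) of (t, \<xi>) \<Rightarrow> K t \<xi>)"
      using K_int by (auto simp: has_bochner_integral_iff)
  qed
  have inner: "(LINT t|lborel. K t \<xi>) = indicator {0<..<x} \<xi> * (Gamma \<beta> * RL_integral \<beta> \<phi> \<xi> / (x - \<xi>) powr \<beta>)"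
    for \<xi>
  proof (cases "\<xi> \<in> {0<..<x}")
    case True
    have "RL_integral \<beta> \<phi> \<xi> = RL_integral \<beta> g \<xi>"
      using g_ae \<phi>m gm True x by (intro RL_integral_cong_AE[where a = a]) auto
    moreover have "Gamma \<beta> * RL_integral \<beta> g \<xi> =
        (LINT t|lborel. indicator {0<..<\<xi>} t * (g t / (\<xi> - t) powr (1 - \<beta>)))"
      unfolding RL_integral_def using G g by (subst integral_lebesgue_on_eq_lborel) auto
    moreover have "(LINT t|lborel. K t \<xi>) =
        (LINT t|lborel. indicator {0<..<\<xi>} t * (g t / (\<xi> - t) powr (1 - \<beta>))) / (x - \<xi>) powr \<beta>"
      unfolding integral_divide_zero[symmetric]
    proof (rule Bochner_Integration.integral_cong[OF refl])
      fix t
      have "(\<xi> - t) powr (\<beta> - 1) = inverse ((\<xi> - t) powr (1 - \<beta>))"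
        by (metis minus_diff_eq powr_minus)
      then show "K t \<xi> = indicator {0<..<\<xi>} t * (g t / (\<xi> - t) powr (1 - \<beta>)) / (x - \<xi>) powr \<beta>"
        using True by (auto simp: K_def k_def indicator_def powr_minus divide_inverse)
    qed
    ultimately show ?thesis using True by simp
  next
    case False
    then have "K t \<xi> = 0" for t by (auto simp: K_def k_def indicator_def)
    then show ?thesis using False by simp
  qed
  have "integrable lborel (\<lambda>\<xi>. LINT t|lborel. K t \<xi>)"
    using lborel_pair.integrable_snd[OF Kpair] .
  then have il: "integrable lborel (\<lambda>\<xi>. indicator {0<..<x} \<xi> * (Gamma \<beta> * RL_integral \<beta> \<phi> \<xi> / (x - \<xi>) powr \<beta>))"
    by (simp only: inner)
  then have "integrable lebesgue (\<lambda>\<xi>. indicator {0<..<x} \<xi> * (Gamma \<beta> * RL_integral \<beta> \<phi> \<xi> / (x - \<xi>) powr \<beta>))"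
    by (subst integrable_completion) auto
  then have "integrable (lebesgue_on {0<..<x}) (\<lambda>\<xi>. Gamma \<beta> * RL_integral \<beta> \<phi> \<xi> / (x - \<xi>) powr \<beta>)"
    by (simp add: integrable_restrict_space)
  then have "integrable (lebesgue_on {0<..<x}) (\<lambda>\<xi>. (1 / Gamma \<beta>) * (Gamma \<beta> * RL_integral \<beta> \<phi> \<xi> / (x - \<xi>) powr \<beta>))"
    by (rule integrable_mult_right)
  then show "integrable (lebesgue_on {0<..<x}) (\<lambda>\<xi>. RL_integral \<beta> \<phi> \<xi> / (x - \<xi>) powr \<beta>)"
    using G by simp
  have "Gamma \<beta> * Gamma (1 - \<beta>) * RL_integral (1 - \<beta>) (RL_integral \<beta> \<phi>) x
      = (LINT \<xi>|lebesgue_on {0<..<x}. Gamma \<beta> * RL_integral \<beta> \<phi> \<xi> / (x - \<xi>) powr \<beta>)"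
    unfolding RL_integral_def[of "1 - \<beta>"] times_divide_eq_right[symmetric] integral_mult_right_zero
    using G by simp
  also have "\<dots> = (LINT \<xi>|lebesgue. indicator {0<..<x} \<xi> * (Gamma \<beta> * RL_integral \<beta> \<phi> \<xi> / (x - \<xi>) powr \<beta>))"
    by (simp add: integral_restrict_space)
  also have "\<dots> = (LINT \<xi>|lborel. LINT t|lborel. K t \<xi>)"
    unfolding inner using il by (intro integral_completion) auto
  also have "\<dots> = (LINT t|lborel. LINT \<xi>|lborel. K t \<xi>)"
    by (rule lborel_pair.Fubini_integral[OF Kpair])
  also have "\<dots> = (LINT t|lborel. indicator {0<..<x} t * g t * (Gamma \<beta> * Gamma (1 - \<beta>)))"
    using has_bochner_integral_integral_eq[OF K_int] by simp
  also have "\<dots> = (LINT t|lebesgue_on {0<..<x}. g t) * (Gamma \<beta> * Gamma (1 - \<beta>))"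
    using g by (subst integral_lebesgue_on_eq_lborel) auto
  also have "(LINT t|lebesgue_on {0<..<x}. g t) = (LINT t|lebesgue_on {0<..<x}. \<phi> t)"
  proof (rule integral_cong_AE)
    show "\<phi> \<in> borel_measurable (lebesgue_on {0<..<x})"
      using \<phi>m by (rule measurable_restrict_mono) (use x in auto)
    show "AE t in lebesgue_on {0<..<x}. g t = \<phi> t"
      using AE_lebesgue_on_initial[OF g_ae, of x] x by (auto elim: eventually_mono)
  qed (rule gm)
  finally show "RL_integral (1 - \<beta>) (RL_integral \<beta> \<phi>) x = (LINT t|lebesgue_on {0<..<x}. \<phi> t)"
    using G by simp
qed

section \<open>Representation of functions with a fractional derivative\<close>

text \<open>
  An element of H_plus is described by a constant c and a density \<phi>, and the semigroup law shows that its
  fractional integral of order 1 - \<beta> is c plus the primitive of \<phi>.  By Lebesgue differentiation \<phi> agrees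
  almost everywhere with the pointwise derivative RL_deriv, and may be replaced by it throughout.
\<close>

lemma H_plus_representation:
  assumes \<beta>: "0 < \<beta>" "\<beta> < 1" and u: "u \<in> H_plus \<beta> a"
  obtains c where
    "square_integrable (lebesgue_on {0<..<a}) (RL_deriv \<beta> u)"
    "AE x in lebesgue_on {0<..<a}. u x = c / Gamma \<beta> * x powr (\<beta> - 1) + RL_integral \<beta> (RL_deriv \<beta> u) x"
    "\<And>x. x \<in> {0<..<a} \<Longrightarrow>
      RL_integral (1 - \<beta>) u x = c + (LINT t|lebesgue_on {0<..<x}. RL_deriv \<beta> u t)"
proof -
  have G: "Gamma \<beta> > 0" "Gamma (1 - \<beta>) > 0" using \<beta> by auto
  obtain c \<phi> where \<phi>: "square_integrable (lebesgue_on {0<..<a}) \<phi>" and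
    ueq: "AE x in lebesgue_on {0<..<a}. u x = c / Gamma \<beta> * x powr (\<beta> - 1) + RL_integral \<beta> \<phi> x"
    using u unfolding H_plus_def AC_frac_def by (auto simp: L2_interval_iff)
  have um: "u \<in> borel_measurable (lebesgue_on {0<..<a})"
    using u by (simp add: H_plus_def L2_interval_def)
  have \<phi>i: "integrable (lebesgue_on {0<..<a}) \<phi>"
    using \<phi> by (rule square_integrable_imp_integrable_interval)
  have y: "RL_integral (1 - \<beta>) u x = c + (LINT t|lebesgue_on {0<..<x}. \<phi> t)" if x: "x \<in> {0<..<a}" for x
  proof -
    let ?M = "lebesgue_on {0<..<x}"
    let ?k = "\<lambda>\<xi>. \<xi> powr (\<beta> - 1) / (x - \<xi>) powr \<beta>"
    have "(\<lambda>\<xi>. indicator {0<..<x} \<xi> *\<^sub>R ?k \<xi>) =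
        (\<lambda>\<xi>. if 0 < \<xi> \<and> \<xi> < x then (\<xi> - 0) powr (\<beta> - 1) * (x - \<xi>) powr (- \<beta>) else 0)"
      by (auto simp: fun_eq_iff indicator_def powr_minus divide_inverse)
    then have "has_bochner_integral lborel (\<lambda>\<xi>. indicator {0<..<x} \<xi> *\<^sub>R ?k \<xi>) (Gamma \<beta> * Gamma (1 - \<beta>))"
      using has_bochner_integral_abel_kernel[OF \<beta>, of 0 x] x by simp
    then have "has_bochner_integral lebesgue (\<lambda>\<xi>. indicator {0<..<x} \<xi> *\<^sub>R ?k \<xi>) (Gamma \<beta> * Gamma (1 - \<beta>))"
      by (auto simp: has_bochner_integral_iff integrable_completion integral_completion)
    then have "has_bochner_integral ?M ?k (Gamma \<beta> * Gamma (1 - \<beta>))"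
      by (simp add: has_bochner_integral_restrict_space)
    then have k: "integrable ?M ?k" "(LINT \<xi>|?M. ?k \<xi>) = Gamma \<beta> * Gamma (1 - \<beta>)"
      by (auto simp: has_bochner_integral_iff)
    have r: "integrable ?M (\<lambda>\<xi>. RL_integral \<beta> \<phi> \<xi> / (x - \<xi>) powr \<beta>)"
      using RL_integral_semigroup(1)[OF \<beta> \<phi>i] x by auto
    have "(LINT \<xi>|?M. u \<xi> / (x - \<xi>) powr \<beta>) =
        (LINT \<xi>|?M. c / Gamma \<beta> * ?k \<xi> + RL_integral \<beta> \<phi> \<xi> / (x - \<xi>) powr \<beta>)"
    proof (rule integral_cong_AE)
      have "u \<in> borel_measurable ?M"
        using um by (rule measurable_restrict_mono) (use x in auto)
      moreover have "(\<lambda>\<xi>. (x - \<xi>) powr \<beta>) \<in> borel_measurable ?M"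
        by (intro measurable_restrict_space1 measurable_completion) auto
      ultimately show "(\<lambda>\<xi>. u \<xi> / (x - \<xi>) powr \<beta>) \<in> borel_measurable ?M" by simp
      show "(\<lambda>\<xi>. c / Gamma \<beta> * ?k \<xi> + RL_integral \<beta> \<phi> \<xi> / (x - \<xi>) powr \<beta>) \<in> borel_measurable ?M"
        using k(1) r by (intro borel_measurable_add borel_measurable_times) auto
      show "AE \<xi> in ?M. u \<xi> / (x - \<xi>) powr \<beta> = c / Gamma \<beta> * ?k \<xi> + RL_integral \<beta> \<phi> \<xi> / (x - \<xi>) powr \<beta>"
        using AE_lebesgue_on_initial[OF ueq, of x] x by (auto elim!: eventually_mono simp: add_divide_distrib)
    qed
    also have "\<dots> = c / Gamma \<beta> * (Gamma \<beta> * Gamma (1 - \<beta>)) + (LINT \<xi>|?M. RL_integral \<beta> \<phi> \<xi> / (x - \<xi>) powr \<beta>)"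
    proof -
      have "integrable ?M (\<lambda>\<xi>. c / Gamma \<beta> * ?k \<xi>)"
        using k(1) by (intro integrable_mult_right)
      from Bochner_Integration.integral_add[OF this r] show ?thesis
        unfolding integral_mult_right_zero k(2) .
    qed
    finally have "RL_integral (1 - \<beta>) u x = c + RL_integral (1 - \<beta>) (RL_integral \<beta> \<phi>) x"
      unfolding RL_integral_def[of "1 - \<beta>"] using G by (simp add: field_simps)
    then show ?thesis
      using RL_integral_semigroup(2)[OF \<beta> \<phi>i] x by simp
  qed
  have deriv: "AE x in lebesgue_on {0<..<a}. \<phi> x = RL_deriv \<beta> u x"
    using AE_deriv_lebesgue_integral[OF \<phi>i] unfolding AE_lebesgue_on_interval
  proof eventually_elim
    case (elim x)
    show ?case
    proof
      assume x: "0 < x \<and> x < a"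
      have "((\<lambda>x. c + (LINT t|lebesgue_on {0<..<x}. \<phi> t)) has_real_derivative \<phi> x) (at x)"
        using elim x by (auto intro!: derivative_eq_intros)
      moreover have "eventually (\<lambda>x. c + (LINT t|lebesgue_on {0<..<x}. \<phi> t) = RL_integral (1 - \<beta>) u x) (nhds x)"
        using x by (intro eventually_nhds_in_open[THEN eventually_mono, of "{0<..<a}"]) (auto simp: y)
      ultimately have "(RL_integral (1 - \<beta>) u has_real_derivative \<phi> x) (at x)"
        using DERIV_cong_ev[of x x "\<lambda>x. c + (LINT t|lebesgue_on {0<..<x}. \<phi> t)" "RL_integral (1 - \<beta>) u"]
        by blast
      then show "\<phi> x = RL_deriv \<beta> u x"
        unfolding RL_deriv_def by (simp add: DERIV_imp_deriv)
    qed
  qed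
  have \<phi>m: "\<phi> \<in> borel_measurable (lebesgue_on {0<..<a})" using \<phi> by (simp add: square_integrable_def)
  have dm: "RL_deriv \<beta> u \<in> borel_measurable (lebesgue_on {0<..<a})"
    using borel_measurable_lebesgue_on_AE[OF \<phi>m _ deriv] by simp
  have eqx: "(LINT t|lebesgue_on {0<..<x}. \<phi> t) = (LINT t|lebesgue_on {0<..<x}. RL_deriv \<beta> u t)"
    if "x \<in> {0<..<a}" for x
  proof (rule integral_cong_AE)
    have "{0<..<x} \<subseteq> {0<..<a}" using that by auto
    then show "\<phi> \<in> borel_measurable (lebesgue_on {0<..<x})" "RL_deriv \<beta> u \<in> borel_measurable (lebesgue_on {0<..<x})"
      using \<phi>m dm measurable_restrict_mono by blast+
    show "AE t in lebesgue_on {0<..<x}. \<phi> t = RL_deriv \<beta> u t"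
      using AE_lebesgue_on_initial[OF deriv, of x] that by simp
  qed
  show thesis
  proof (rule that[of c])
    show "square_integrable (lebesgue_on {0<..<a}) (RL_deriv \<beta> u)"
      using square_integrable_cong_AE[OF \<phi> dm deriv] .
    have "RL_integral \<beta> \<phi> x = RL_integral \<beta> (RL_deriv \<beta> u) x" if "x \<le> a" for x
      using RL_integral_cong_AE[OF deriv \<phi>m dm that] .
    then show "AE x in lebesgue_on {0<..<a}. u x = c / Gamma \<beta> * x powr (\<beta> - 1) + RL_integral \<beta> (RL_deriv \<beta> u) x"
      using ueq unfolding AE_lebesgue_on_interval by (auto elim!: eventually_mono)
    show "RL_integral (1 - \<beta>) u x = c + (LINT t|lebesgue_on {0<..<x}. RL_deriv \<beta> u t)"
      if "x \<in> {0<..<a}" for x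
      using y[OF that] eqx[OF that] by simp
  qed
qed

text \<open>
  The Riesz representer of the functional that sends \<phi> to the value of its fractional integral at x.  It is square
  integrable exactly because \<beta> > 1/2.
\<close>

definition RL_kernel :: "real \<Rightarrow> real \<Rightarrow> real \<Rightarrow> real" where
  "RL_kernel \<beta> x t = (if t < x then 1 / Gamma \<beta> / (x - t) powr (1 - \<beta>) else 0)"

lemma RL_kernel_square_integrable:
  assumes \<beta>: "1 / 2 < \<beta>" "\<beta> < 1" and x: "x \<in> {0<..<a}"
  shows "square_integrable (lebesgue_on {0<..<a}) (RL_kernel \<beta> x)"
    and "(LINT t|lebesgue_on {0<..<a}. (RL_kernel \<beta> x t)\<^sup>2) \<le> a powr (2 * \<beta> - 1) / ((2 * \<beta> - 1) * (Gamma \<beta>)\<^sup>2)"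
proof -
  let ?s = "2 * \<beta> - 2"
  have km: "RL_kernel \<beta> x \<in> borel_measurable (lebesgue_on {0<..<a})"
    unfolding RL_kernel_def by (intro measurable_restrict_space1 measurable_completion) auto
  have "((\<lambda>t. t powr ?s) has_integral x powr (?s + 1) / (?s + 1)) {0..x}"
    using has_integral_powr_from_0[of ?s x] \<beta> x by auto
  then have "((\<lambda>t. (x - t) powr ?s) has_integral x powr (?s + 1) / (?s + 1)) {0..x}"
    using has_integral_affinity[of "\<lambda>t. t powr ?s" _ 0 x "-1" x] x
    by (simp add: cbox_interval image_affinity_atLeastAtMost_diff minus_diff_commute)
  then have i: "((\<lambda>t. (x - t) powr ?s) has_integral x powr (?s + 1) / (?s + 1)) {0<..<x}"
    by (simp add: has_integral_Icc_iff_Ioo)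
  then have "(\<lambda>t. (x - t) powr ?s) absolutely_integrable_on {0<..<x}"
    by (intro nonnegative_absolutely_integrable_1) auto
  then have ii: "integrable (lebesgue_on {0<..<x}) (\<lambda>t. (x - t) powr ?s)"
    by (rule absolutely_integrable_imp_integrable) simp
  have sq: "(RL_kernel \<beta> x t)\<^sup>2 = (if t \<in> {0<..<x} then (1 / (Gamma \<beta>)\<^sup>2) * (x - t) powr ?s else 0)"
    if "t \<in> {0<..<a}" for t
  proof -
    have "((x - t) powr (1 - \<beta>))\<^sup>2 = inverse ((x - t) powr ?s)" if "t < x"
      unfolding power2_eq_square powr_add[symmetric] powr_minus[symmetric] by simp
    then show ?thesis using that by (auto simp: RL_kernel_def power_divide divide_inverse power_mult_distrib power_inverse)
  qed
  have ii2: "integrable (lebesgue_on {0<..<x}) (\<lambda>t. (1 / (Gamma \<beta>)\<^sup>2) * (x - t) powr ?s)"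
    using ii by simp
  have "integrable (lebesgue_on {0<..<a}) (\<lambda>t. if t \<in> {0<..<x} then (1 / (Gamma \<beta>)\<^sup>2) * (x - t) powr ?s else 0)"
  proof -
    have "integrable lebesgue (\<lambda>t. if t \<in> {0<..<x} then (1 / (Gamma \<beta>)\<^sup>2) * (x - t) powr ?s else 0)"
      using ii2 by (intro Lebesgue_Measure.integrable_restrict_UNIV[THEN iffD2]) simp_all
    from integrable_mult_indicator[OF _ this, of "{0<..<a}"] show ?thesis
      by (simp add: integrable_restrict_space)
  qed
  then have "integrable (lebesgue_on {0<..<a}) (\<lambda>t. (RL_kernel \<beta> x t)\<^sup>2)"
    using sq by (subst Bochner_Integration.integrable_cong[OF refl]) auto
  then show "square_integrable (lebesgue_on {0<..<a}) (RL_kernel \<beta> x)"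
    using km by (simp add: square_integrable_def)
  have "(LINT t|lebesgue_on {0<..<a}. (RL_kernel \<beta> x t)\<^sup>2) =
      (LINT t|lebesgue_on {0<..<a}. (if t \<in> {0<..<x} then (1 / (Gamma \<beta>)\<^sup>2) * (x - t) powr ?s else 0))"
    using sq by (intro Bochner_Integration.integral_cong) auto
  also have "\<dots> = (LINT t|lebesgue_on {0<..<x}. (1 / (Gamma \<beta>)\<^sup>2) * (x - t) powr ?s)"
    using x by (intro Lebesgue_Measure.integral_restrict) auto
  also have "\<dots> = (1 / (Gamma \<beta>)\<^sup>2) * (x powr (2 * \<beta> - 1) / (2 * \<beta> - 1))"
    using lebesgue_integral_eq_integral[OF ii] i by (simp add: integral_unique)
  also have "\<dots> \<le> (1 / (Gamma \<beta>)\<^sup>2) * (a powr (2 * \<beta> - 1) / (2 * \<beta> - 1))"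
    using x \<beta> by (intro mult_left_mono divide_right_mono powr_mono2) auto
  finally show "(LINT t|lebesgue_on {0<..<a}. (RL_kernel \<beta> x t)\<^sup>2) \<le> a powr (2 * \<beta> - 1) / ((2 * \<beta> - 1) * (Gamma \<beta>)\<^sup>2)"
    by (simp add: mult.commute)
qed

lemma RL_integral_eq_kernel:
  assumes "x \<in> {0<..<a}"
  shows "RL_integral \<beta> \<phi> x = (LINT t|lebesgue_on {0<..<a}. RL_kernel \<beta> x t * \<phi> t)"
proof -
  have "(LINT t|lebesgue_on {0<..<a}. RL_kernel \<beta> x t * \<phi> t) =
      (LINT t|lebesgue_on {0<..<a}. (if t \<in> {0<..<x} then (1 / Gamma \<beta>) * (\<phi> t / (x - t) powr (1 - \<beta>)) else 0))"
    by (intro Bochner_Integration.integral_cong) (auto simp: RL_kernel_def)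
  also have "\<dots> = (LINT t|lebesgue_on {0<..<x}. (1 / Gamma \<beta>) * (\<phi> t / (x - t) powr (1 - \<beta>)))"
    using assms by (intro Lebesgue_Measure.integral_restrict) auto
  finally show ?thesis unfolding RL_integral_def integral_mult_right_zero by simp
qed

text \<open>
  The squared L2 norm of the kernel at the right end x = a, which is the largest one.
\<close>

definition RL_kernel_bound :: "real \<Rightarrow> real \<Rightarrow> real" where
  "RL_kernel_bound \<beta> a = a powr (2 * \<beta> - 1) / ((2 * \<beta> - 1) * (Gamma \<beta>)\<^sup>2)"

section \<open>Estimates for orthonormal families of solutions\<close>

text \<open>
  Bound for the coefficients of the singular part on an edge of length a.  The denominator is the square of
  the integral of x powr (\<beta> - 1) / Gamma \<beta> over the edge; the two summands of the numerator come from
  Bessel's inequality for the functions and for their fractional derivatives.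
\<close>

definition singular_part_bound :: "real \<Rightarrow> real \<Rightarrow> real \<Rightarrow> real \<Rightarrow> real" where
  "singular_part_bound \<beta> a0 R0 a =
     (2 * (a / R0) + 2 * (a * (a * (RL_kernel_bound \<beta> a / a0)))) / (a powr \<beta> / (\<beta> * Gamma \<beta>))\<^sup>2"

locale orthonormal_solutions =
  fixes G :: "('v, 'e) pre_digraph" and l \<beta> p r a0 a1 R0 R1 lam u
  assumes metric: "metric_graph G l"
    and \<beta>: "1 / 2 < \<beta>" "\<beta> < 1" and a0: "0 < a0" and R0: "0 < R0"
    and p_cont: "edgewise_uniformly_continuous G l p" and r_cont: "edgewise_uniformly_continuous G l r"
    and p_bounds: "\<And>e x. e \<in> arcs G \<Longrightarrow> x \<in> {0<..<l e} \<Longrightarrow> a0 \<le> p e x \<and> p e x \<le> a1"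
    and r_bounds: "\<And>e x. e \<in> arcs G \<Longrightarrow> x \<in> {0<..<l e} \<Longrightarrow> R0 \<le> r e x \<and> r e x \<le> R1"
    and solution: "\<And>k. generalized_solution G l \<beta> p r (lam k) (u k)"
    and orthonormal: "weighted_orthonormal G l r u"
begin

abbreviation edge :: "'e \<Rightarrow> real measure" where "edge e \<equiv> lebesgue_on {0<..<l e}"

abbreviation du :: "nat \<Rightarrow> 'e \<Rightarrow> real \<Rightarrow> real" where "du k e \<equiv> RL_deriv \<beta> (u k e)"

lemma finite_arcs: "finite (arcs G)"
  using metric by (simp add: metric_graph_def fin_digraph.finite_arcs)

lemma length_pos: "e \<in> arcs G \<Longrightarrow> 0 < l e"
  using metric by (simp add: metric_graph_def)

lemma \<beta>_pos: "0 < \<beta>"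
  using \<beta> by simp

lemma u_Dir: "u k \<in> H_graph_Dir G l \<beta>"
  using solution[of k] by (simp add: generalized_solution_def)

lemma u_H_plus: "e \<in> arcs G \<Longrightarrow> u k e \<in> H_plus \<beta> (l e)"
  using u_Dir[of k] by (simp add: H_graph_Dir_def H_graph_def)

lemma u_square_integrable: "e \<in> arcs G \<Longrightarrow> square_integrable (edge e) (u k e)"
  using u_H_plus by (simp add: H_plus_def L2_interval_iff)

text \<open>
  The coefficient of the singular part of u k on e, which is also the limit at the left end of the
  fractional integral of order 1 - \<beta>.
\<close>

definition coef :: "nat \<Rightarrow> 'e \<Rightarrow> real" where
  "coef k e = (SOME c.
     (AE x in edge e. u k e x = c / Gamma \<beta> * x powr (\<beta> - 1) + RL_integral \<beta> (du k e) x) \<and>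
     (\<forall>x\<in>{0<..<l e}. RL_integral (1 - \<beta>) (u k e) x = c + (LINT t|lebesgue_on {0<..<x}. du k e t)))"

lemma du_square_integrable: "e \<in> arcs G \<Longrightarrow> square_integrable (edge e) (du k e)"
  by (rule H_plus_representation[OF \<beta>_pos \<beta>(2) u_H_plus])

lemma coef_properties:
  assumes e: "e \<in> arcs G"
  shows u_eq: "AE x in edge e. u k e x = coef k e / Gamma \<beta> * x powr (\<beta> - 1) + RL_integral \<beta> (du k e) x"
    and RL_u_eq: "\<And>x. x \<in> {0<..<l e} \<Longrightarrow>
      RL_integral (1 - \<beta>) (u k e) x = coef k e + (LINT t|lebesgue_on {0<..<x}. du k e t)"
proof -
  let ?P = "\<lambda>c. (AE x in edge e. u k e x = c / Gamma \<beta> * x powr (\<beta> - 1) + RL_integral \<beta> (du k e) x) \<and>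
     (\<forall>x\<in>{0<..<l e}. RL_integral (1 - \<beta>) (u k e) x = c + (LINT t|lebesgue_on {0<..<x}. du k e t))"
  have "\<exists>c. ?P c"
    by (rule H_plus_representation[OF \<beta>_pos \<beta>(2) u_H_plus[OF e, of k]]) blast
  then have "?P (coef k e)" unfolding coef_def by (rule someI_ex)
  then show "AE x in edge e. u k e x = coef k e / Gamma \<beta> * x powr (\<beta> - 1) + RL_integral \<beta> (du k e) x"
    "\<And>x. x \<in> {0<..<l e} \<Longrightarrow>
      RL_integral (1 - \<beta>) (u k e) x = coef k e + (LINT t|lebesgue_on {0<..<x}. du k e t)"
    by blast+
qed

lemma weights_measurable:
  assumes "e \<in> arcs G"
  shows "p e \<in> borel_measurable (edge e)" "r e \<in> borel_measurable (edge e)"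
  using assms p_cont r_cont unfolding edgewise_uniformly_continuous_def
  by (auto intro!: continuous_imp_measurable_on_sets_lebesgue uniformly_continuous_imp_continuous)

lemma u_orthonormal:
  "(\<Sum>e\<in>arcs G. LINT x|edge e. r e x * u j e x * u k e x) = (if j = k then 1 else 0)"
  using orthonormal by (simp add: weighted_orthonormal_def graph_inner_def)

text \<open>
  The weak equation for u j, tested with u k.
\<close>

lemma du_orthogonal:
  "(\<Sum>e\<in>arcs G. LINT x|edge e. p e x * du j e x * du k e x) = (if j = k then lam j else 0)"
  using solution[of j] u_Dir[of k] orthonormal
  by (auto simp: generalized_solution_def weighted_orthonormal_def graph_inner_def)

lemma lam_nonneg: "0 \<le> lam k"
proof -
  have "0 \<le> (\<Sum>e\<in>arcs G. LINT x|edge e. p e x * du k e x * du k e x)"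
  proof (intro sum_nonneg integral_nonneg_AE AE_I2)
    fix e x assume "e \<in> arcs G" "x \<in> space (edge e)"
    then have "0 \<le> p e x * (du k e x)\<^sup>2" using p_bounds[of e x] a0 by simp
    then show "0 \<le> p e x * du k e x * du k e x" by (simp add: power2_eq_square mult.assoc)
  qed
  then show ?thesis by (simp add: du_orthogonal)
qed

text \<open>
  Bounded by 1 and, after multiplication by lam k, still bounded by 1, these factors serve the orthonormal
  family u and the orthogonal family du at the same time, also when lam k = 0.
\<close>

definition damping :: "nat \<Rightarrow> real" where "damping k = 1 / (1 + lam k)"

lemma damping: "0 < damping k" "damping k \<le> 1" "damping k * lam k \<le> 1"
  using lam_nonneg[of k] by (auto simp: damping_def field_simps)

lemma damping_nonneg: "0 \<le> damping k"
  using damping(1)[of k] by simp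

lemma bessel_u:
  assumes "e \<in> arcs G" "finite S" "square_integrable (edge e) h"
  shows "(\<Sum>k\<in>S. damping k * (LINT x|edge e. h x * u k e x)\<^sup>2) \<le> (LINT x|edge e. (h x)\<^sup>2) / R0"
  by (rule bessel_inequality_edge[where A = "arcs G" and q = r and ?q1.0 = R1 and c = "\<lambda>k. 1" and f = u])
    (simp_all add: assms finite_arcs weights_measurable r_bounds R0 u_square_integrable u_orthonormal
      damping damping_nonneg)

lemma bessel_du:
  assumes "e \<in> arcs G" "finite S" "square_integrable (edge e) h"
  shows "(\<Sum>k\<in>S. damping k * (LINT x|edge e. h x * du k e x)\<^sup>2) \<le> (LINT x|edge e. (h x)\<^sup>2) / a0"
  by (rule bessel_inequality_edge[where A = "arcs G" and q = p and ?q1.0 = a1 and c = lam and f = du])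
    (simp_all add: assms finite_arcs weights_measurable p_bounds a0 du_square_integrable du_orthogonal
      damping damping_nonneg)

text \<open>
  Bessel's inequality for the derivatives, tested with the kernel.
\<close>

lemma sum_regular_part:
  assumes "e \<in> arcs G" "finite S" "x \<in> {0<..<l e}"
  shows "(\<Sum>k\<in>S. damping k * (RL_integral \<beta> (du k e) x)\<^sup>2) \<le> RL_kernel_bound \<beta> (l e) / a0"
proof -
  have "(\<Sum>k\<in>S. damping k * (RL_integral \<beta> (du k e) x)\<^sup>2)
      \<le> (LINT t|edge e. (RL_kernel \<beta> x t)\<^sup>2) / a0"
    using bessel_du[OF assms(1,2) RL_kernel_square_integrable(1)[OF \<beta> assms(3)]]
    by (simp add: RL_integral_eq_kernel[OF assms(3)])
  also have "\<dots> \<le> RL_kernel_bound \<beta> (l e) / a0"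
    unfolding RL_kernel_bound_def
    using RL_kernel_square_integrable(2)[OF \<beta> assms(3)] a0 by (intro divide_right_mono) auto
  finally show ?thesis .
qed

lemma powr_square_integrable: "0 \<le> a \<Longrightarrow> square_integrable (lebesgue_on {0<..<a}) (\<lambda>x. x powr (\<beta> - 1))"
proof -
  assume a: "0 \<le> a"
  have "(x powr (\<beta> - 1))\<^sup>2 = x powr (2 * \<beta> - 2)" for x :: real
    unfolding power2_eq_square powr_add[symmetric] by (simp add: algebra_simps)
  then show ?thesis
    using powr_has_integral_from_0(1)[of "2 * \<beta> - 2" a] powr_has_integral_from_0(1)[of "\<beta> - 1" a] \<beta> a
    by (simp add: square_integrable_def)
qed

text \<open>
  Up to a null set the regular part is the difference of u and its singular part; this also settles its
  measurability.
\<close>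

lemma RL_du_square_integrable:
  assumes e: "e \<in> arcs G"
  shows "square_integrable (edge e) (RL_integral \<beta> (du k e))"
proof -
  have s: "square_integrable (edge e) (\<lambda>x. u k e x + (- coef k e / Gamma \<beta>) * x powr (\<beta> - 1))"
    using u_square_integrable[OF e] powr_square_integrable[of "l e"] length_pos[OF e]
    by (intro square_integrable_add square_integrable_scale) auto
  have ae: "AE x in edge e. u k e x + (- coef k e / Gamma \<beta>) * x powr (\<beta> - 1) = RL_integral \<beta> (du k e) x"
    using u_eq[OF e, of k] by eventually_elim simp
  have "RL_integral \<beta> (du k e) \<in> borel_measurable (edge e)"
    using borel_measurable_lebesgue_on_AE[OF _ _ ae] s by (auto simp: square_integrable_def)
  from square_integrable_cong_AE[OF s this ae] show ?thesis .
qed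

text \<open>
  Integrate u k = singular part + regular part over the edge and solve for the coefficient.  The integrals
  of u k are controlled by Bessel's inequality tested with the constant 1, those of the regular part by its
  pointwise bound.
\<close>

lemma sum_coef:
  assumes e: "e \<in> arcs G" and S: "finite S"
  shows "(\<Sum>k\<in>S. damping k * (coef k e)\<^sup>2) \<le> singular_part_bound \<beta> a0 R0 (l e)"
proof -
  let ?a = "l e" let ?R = "\<lambda>k. RL_integral \<beta> (du k e)"
  define A where "A = ?a powr \<beta> / (\<beta> * Gamma \<beta>)"
  have a: "0 < ?a" using length_pos[OF e] .
  have A: "0 < A" using \<beta> a by (simp add: A_def)
  have Ri: "integrable (edge e) (?R k)" "integrable (edge e) (\<lambda>x. (?R k x)\<^sup>2)" for k
    using square_integrable_imp_integrable_interval[OF RL_du_square_integrable[OF e, of k]]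
      RL_du_square_integrable[OF e, of k]
    by (simp_all add: square_integrable_def)
  have Ac: "A * coef k e = (LINT x|edge e. u k e x) - (LINT x|edge e. ?R k x)" for k
  proof -
    \<comment> \<open>the singular part has integral A times its coefficient\<close>
    have P: "integrable (edge e) (\<lambda>x. x powr (\<beta> - 1))" "(LINT x|edge e. x powr (\<beta> - 1)) = ?a powr \<beta> / \<beta>"
      using powr_has_integral_from_0[of "\<beta> - 1" ?a] \<beta> a by auto
    have Pc: "integrable (edge e) (\<lambda>x. coef k e / Gamma \<beta> * x powr (\<beta> - 1))"
      using P(1) by (intro integrable_mult_right)
    have "(LINT x|edge e. u k e x) = (LINT x|edge e. coef k e / Gamma \<beta> * x powr (\<beta> - 1) + ?R k x)"
    proof (rule integral_cong_AE)
      show "u k e \<in> borel_measurable (edge e)"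
        using u_square_integrable[OF e] by (simp add: square_integrable_def)
      show "(\<lambda>x. coef k e / Gamma \<beta> * x powr (\<beta> - 1) + ?R k x) \<in> borel_measurable (edge e)"
        using Pc Ri(1) by (intro borel_measurable_add) auto
    qed (rule u_eq[OF e])
    also have "\<dots> = coef k e / Gamma \<beta> * (?a powr \<beta> / \<beta>) + (LINT x|edge e. ?R k x)"
      using Bochner_Integration.integral_add[OF Pc Ri(1)] unfolding integral_mult_right_zero P(2) .
    finally show ?thesis by (simp add: A_def field_simps)
  qed
  have sumR: "(\<Sum>k\<in>S. damping k * (LINT x|edge e. ?R k x)\<^sup>2) \<le> ?a * (?a * (RL_kernel_bound \<beta> ?a / a0))"
  proof -
    have "(\<Sum>k\<in>S. damping k * (LINT x|edge e. ?R k x)\<^sup>2)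
        \<le> (\<Sum>k\<in>S. damping k * (?a * (LINT x|edge e. (?R k x)\<^sup>2)))"
      using square_integral_interval_le[OF RL_du_square_integrable[OF e] a] damping_nonneg
      by (intro sum_mono mult_left_mono) auto
    also have "\<dots> = ?a * (LINT x|edge e. (\<Sum>k\<in>S. damping k * (?R k x)\<^sup>2))"
      using Ri by (subst Bochner_Integration.integral_sum) (auto simp: sum_distrib_left mult_ac)
    also have "\<dots> \<le> ?a * (LINT x|edge e. RL_kernel_bound \<beta> ?a / a0)"
    proof (intro mult_left_mono integral_mono)
      show "integrable (edge e) (\<lambda>x. \<Sum>k\<in>S. damping k * (?R k x)\<^sup>2)"
        using Ri by (intro Bochner_Integration.integrable_sum integrable_mult_right)
      show "integrable (edge e) (\<lambda>x. RL_kernel_bound \<beta> ?a / a0)"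
        using square_integrable_imp_integrable_interval[OF square_integrable_const_interval] .
    qed (use sum_regular_part[OF e S] a in auto)
    also have "\<dots> = ?a * (?a * (RL_kernel_bound \<beta> ?a / a0))"
      using a by (simp add: measure_restrict_space)
    finally show ?thesis .
  qed
  have sumU: "(\<Sum>k\<in>S. damping k * (LINT x|edge e. u k e x)\<^sup>2) \<le> ?a / R0"
    using bessel_u[OF e S square_integrable_const_interval[of ?a 1]] a
    by (simp add: measure_restrict_space)
  have "A\<^sup>2 * (\<Sum>k\<in>S. damping k * (coef k e)\<^sup>2) = (\<Sum>k\<in>S. damping k * (A * coef k e)\<^sup>2)"
    by (simp add: sum_distrib_left power_mult_distrib mult_ac)
  also have "\<dots> \<le> (\<Sum>k\<in>S. damping k * (2 * (LINT x|edge e. u k e x)\<^sup>2 + 2 * (LINT x|edge e. ?R k x)\<^sup>2))"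
  proof (intro sum_mono mult_left_mono)
    have "(s - t)\<^sup>2 \<le> 2 * s\<^sup>2 + 2 * t\<^sup>2" for s t :: real
      using zero_le_power2[of "s + t"] unfolding power2_diff power2_sum by linarith
    then show "(A * coef k e)\<^sup>2 \<le> 2 * (LINT x|edge e. u k e x)\<^sup>2 + 2 * (LINT x|edge e. ?R k x)\<^sup>2" for k
      unfolding Ac .
  qed (rule damping_nonneg)
  also have "\<dots> = 2 * (\<Sum>k\<in>S. damping k * (LINT x|edge e. u k e x)\<^sup>2)
      + 2 * (\<Sum>k\<in>S. damping k * (LINT x|edge e. ?R k x)\<^sup>2)"
    by (simp add: sum_distrib_left sum.distrib distrib_left mult_ac)
  also have "\<dots> \<le> 2 * (?a / R0) + 2 * (?a * (?a * (RL_kernel_bound \<beta> ?a / a0)))"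
    using sumU sumR by linarith
  finally show ?thesis
    using A unfolding singular_part_bound_def A_def[symmetric] by (simp add: field_simps)
qed

text \<open>
  A single term of the sums bounded above: coefficient and primitive of the derivative are each at most a
  constant times sqrt (1 + lam k).
\<close>

lemma abs_RL_u_le:
  assumes e: "e \<in> arcs G" and x: "x \<in> {0<..<l e}"
  shows "\<bar>RL_integral (1 - \<beta>) (u k e) x\<bar>
    \<le> (sqrt (singular_part_bound \<beta> a0 R0 (l e)) + sqrt (l e / a0)) * (1 + sqrt (lam k))"
proof -
  \<comment> \<open>a bound with the factor 1 / (1 + lam k) becomes one by 1 + sqrt (lam k), by subadditivity of sqrt\<close>
  have undamp: "\<bar>z\<bar> \<le> sqrt B * (1 + sqrt (lam k))" if "damping k * z\<^sup>2 \<le> B" for z B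
  proof -
    have "z\<^sup>2 \<le> B * (1 + lam k)"
      using that lam_nonneg[of k] by (simp add: damping_def field_simps)
    then have "\<bar>z\<bar> \<le> sqrt B * sqrt (1 + lam k)"
      by (metis real_sqrt_abs real_sqrt_le_iff real_sqrt_mult)
    also have "\<dots> \<le> sqrt B * (1 + sqrt (lam k))"
    proof (intro mult_left_mono)
      show "sqrt (1 + lam k) \<le> 1 + sqrt (lam k)"
        using sqrt_add_le_add_sqrt[of 1 "lam k"] lam_nonneg by simp
      have "0 \<le> damping k * z\<^sup>2" using damping_nonneg by simp
      with that show "0 \<le> sqrt B" by simp
    qed
    finally show ?thesis .
  qed
  have "damping k * (coef k e)\<^sup>2 \<le> singular_part_bound \<beta> a0 R0 (l e)"
    using sum_coef[OF e, of "{k}"] by simp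
  note c = undamp[OF this]
  \<comment> \<open>the indicator of (0, x) turns the primitive at x into an inner product on the whole edge\<close>
  define h where "h t = (if t \<in> {0<..<x} then 1 else 0 :: real)" for t
  have hm: "h \<in> borel_measurable (edge e)"
    unfolding h_def by (intro measurable_restrict_space1 measurable_completion) auto
  have "square_integrable (edge e) (\<lambda>t. h t * 1)"
    using square_integrable_const_interval hm
    by (rule square_integrable_bounded_mult[where B = 1]) (simp add: h_def)
  then have h: "square_integrable (edge e) h" by simp
  have du_x: "(LINT t|lebesgue_on {0<..<x}. du k e t) = (LINT t|edge e. h t * du k e t)"
  proof -
    have "(LINT t|edge e. h t * du k e t) = (LINT t|edge e. (if t \<in> {0<..<x} then du k e t else 0))"
      by (intro Bochner_Integration.integral_cong) (auto simp: h_def)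
    also have "\<dots> = (LINT t|lebesgue_on {0<..<x}. du k e t)"
      using x by (intro Lebesgue_Measure.integral_restrict) auto
    finally show ?thesis ..
  qed
  have "(LINT t|edge e. (h t)\<^sup>2) \<le> (LINT t|edge e. 1)"
    using h square_integrable_imp_integrable_interval[OF square_integrable_const_interval[of "l e" 1]]
    by (intro integral_mono) (auto simp: h_def square_integrable_def)
  also have "\<dots> = l e" using x by (simp add: measure_restrict_space)
  finally have "(LINT t|edge e. (h t)\<^sup>2) / a0 \<le> l e / a0"
    using a0 by (intro divide_right_mono) auto
  then have "damping k * (LINT t|lebesgue_on {0<..<x}. du k e t)\<^sup>2 \<le> l e / a0"
    using bessel_du[OF e _ h, of "{k}"] unfolding du_x by simp
  note d = undamp[OF this]
  show ?thesis
    unfolding RL_u_eq[OF e x] using c d by (simp add: distrib_right)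
qed

text \<open>
  Insert 1 = \<integral> r u_k^2 into each term.  The sum of the damped squares of u_k has an integrable majorant F on
  every edge that is the same for all finite index sets.
\<close>

lemma sum_damping_bounded:
  "\<exists>B. \<forall>S. finite S \<longrightarrow> (\<Sum>k\<in>S. damping k) \<le> B"
proof -
  define D where "D e = 2 * (singular_part_bound \<beta> a0 R0 (l e) / (Gamma \<beta>)\<^sup>2)" for e
  define F where "F e x = D e * x powr (2 * \<beta> - 2) + 2 * (RL_kernel_bound \<beta> (l e) / a0)" for e and x :: real
  have edge_bound: "(\<Sum>k\<in>S. damping k * (LINT x|edge e. r e x * u k e x * u k e x)) \<le> R1 * (LINT x|edge e. F e x)"
    if S: "finite S" and e: "e \<in> arcs G" for S e
  proof -
    have a: "0 < l e" using length_pos[OF e] .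
    then have "0 < l e / 2 \<and> l e / 2 < l e" by simp
    then have R1: "0 \<le> R1" using r_bounds[OF e, of "l e / 2"] R0 by auto
    have ui: "integrable (edge e) (\<lambda>x. (u k e x)\<^sup>2)" for k
      using u_square_integrable[OF e] by (simp add: square_integrable_def)
    have Fi: "integrable (edge e) (F e)"
      unfolding F_def
      using powr_has_integral_from_0(1)[of "2 * \<beta> - 2" "l e"] \<beta> a
      by (intro Bochner_Integration.integrable_add integrable_mult_right
          square_integrable_imp_integrable_interval[OF square_integrable_const_interval]) auto
    have weight: "(LINT x|edge e. r e x * u k e x * u k e x) \<le> R1 * (LINT x|edge e. (u k e x)\<^sup>2)" for k
    proof -
      have "square_integrable (edge e) (\<lambda>x. r e x * u k e x)"
        using r_bounds[OF e] R0
        by (intro square_integrable_bounded_mult[where B = R1] u_square_integrable[OF e] weights_measurable[OF e])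
          (auto, force)
      then have "integrable (edge e) (\<lambda>x. r e x * u k e x * u k e x)"
        using u_square_integrable[OF e] by (rule square_integrable_mult)
      then have "(LINT x|edge e. r e x * u k e x * u k e x) \<le> (LINT x|edge e. R1 * (u k e x)\<^sup>2)"
      proof (rule integral_mono)
        show "integrable (edge e) (\<lambda>x. R1 * (u k e x)\<^sup>2)" using ui by (rule integrable_mult_right)
        fix x assume "x \<in> space (edge e)"
        then have "r e x * (u k e x)\<^sup>2 \<le> R1 * (u k e x)\<^sup>2"
          using r_bounds[OF e, of x] by (intro mult_right_mono) auto
        then show "r e x * u k e x * u k e x \<le> R1 * (u k e x)\<^sup>2"
          by (simp add: power2_eq_square mult.assoc)
      qed
      then show ?thesis by simp
    qed
    have pointwise: "AE x in edge e. (\<Sum>k\<in>S. damping k * (u k e x)\<^sup>2) \<le> F e x"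
    proof -
      have "AE x in edge e. \<forall>k\<in>S. u k e x = coef k e / Gamma \<beta> * x powr (\<beta> - 1) + RL_integral \<beta> (du k e) x"
        using u_eq[OF e] S by (intro AE_finite_allI) auto
      moreover have "AE x in edge e. x \<in> {0<..<l e}" by (rule AE_I2) simp
      ultimately show ?thesis
      proof eventually_elim
        case (elim x)
        have "(\<Sum>k\<in>S. damping k * (u k e x)\<^sup>2) \<le> (\<Sum>k\<in>S.
            2 * (x powr (2 * \<beta> - 2) / (Gamma \<beta>)\<^sup>2) * (damping k * (coef k e)\<^sup>2)
            + 2 * (damping k * (RL_integral \<beta> (du k e) x)\<^sup>2))"
        proof (rule sum_mono)
          fix k assume k: "k \<in> S"
          have sq: "(s + t)\<^sup>2 \<le> 2 * s\<^sup>2 + 2 * t\<^sup>2" for s t :: real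
            using zero_le_power2[of "s - t"] unfolding power2_diff power2_sum by linarith
          have xx: "(x powr (\<beta> - 1))\<^sup>2 = x powr (2 * \<beta> - 2)"
            unfolding power2_eq_square powr_add[symmetric] by (simp add: algebra_simps)
          have "(u k e x)\<^sup>2 \<le> 2 * (coef k e / Gamma \<beta> * x powr (\<beta> - 1))\<^sup>2 + 2 * (RL_integral \<beta> (du k e) x)\<^sup>2"
            using elim k sq by simp
          also have "(coef k e / Gamma \<beta> * x powr (\<beta> - 1))\<^sup>2 = x powr (2 * \<beta> - 2) / (Gamma \<beta>)\<^sup>2 * (coef k e)\<^sup>2"
            unfolding power_mult_distrib xx by (simp add: power_divide)
          finally have "damping k * (u k e x)\<^sup>2 \<le> damping k *
              (2 * (x powr (2 * \<beta> - 2) / (Gamma \<beta>)\<^sup>2 * (coef k e)\<^sup>2) + 2 * (RL_integral \<beta> (du k e) x)\<^sup>2)"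
            using damping_nonneg by (intro mult_left_mono)
          then show "damping k * (u k e x)\<^sup>2 \<le> 2 * (x powr (2 * \<beta> - 2) / (Gamma \<beta>)\<^sup>2) * (damping k * (coef k e)\<^sup>2)
            + 2 * (damping k * (RL_integral \<beta> (du k e) x)\<^sup>2)"
            by (simp add: distrib_left mult_ac)
        qed
        also have "\<dots> = 2 * (x powr (2 * \<beta> - 2) / (Gamma \<beta>)\<^sup>2) * (\<Sum>k\<in>S. damping k * (coef k e)\<^sup>2)
            + 2 * (\<Sum>k\<in>S. damping k * (RL_integral \<beta> (du k e) x)\<^sup>2)"
          by (simp only: sum.distrib sum_distrib_left)
        also have "\<dots> \<le> 2 * (x powr (2 * \<beta> - 2) / (Gamma \<beta>)\<^sup>2) * singular_part_bound \<beta> a0 R0 (l e)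
            + 2 * (RL_kernel_bound \<beta> (l e) / a0)"
          using sum_coef[OF e S] sum_regular_part[OF e S elim(2)]
          by (intro add_mono mult_left_mono) auto
        finally show ?case by (simp add: F_def D_def mult_ac)
      qed
    qed
    have "(\<Sum>k\<in>S. damping k * (LINT x|edge e. r e x * u k e x * u k e x))
        \<le> (\<Sum>k\<in>S. damping k * (R1 * (LINT x|edge e. (u k e x)\<^sup>2)))"
      using weight damping_nonneg by (intro sum_mono mult_left_mono)
    also have "\<dots> = R1 * (LINT x|edge e. (\<Sum>k\<in>S. damping k * (u k e x)\<^sup>2))"
      using ui by (subst Bochner_Integration.integral_sum) (auto simp: sum_distrib_left mult_ac)
    also have "\<dots> \<le> R1 * (LINT x|edge e. F e x)"
      using pointwise ui Fi R1
      by (intro mult_left_mono integral_mono_AE Bochner_Integration.integrable_sum integrable_mult_right) auto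
    finally show ?thesis .
  qed
  have "(\<Sum>k\<in>S. damping k) \<le> (\<Sum>e\<in>arcs G. R1 * (LINT x|edge e. F e x))" if S: "finite S" for S
  proof -
    have "(\<Sum>k\<in>S. damping k) = (\<Sum>k\<in>S. damping k * (\<Sum>e\<in>arcs G. LINT x|edge e. r e x * u k e x * u k e x))"
      by (simp add: u_orthonormal)
    also have "\<dots> = (\<Sum>e\<in>arcs G. \<Sum>k\<in>S. damping k * (LINT x|edge e. r e x * u k e x * u k e x))"
      unfolding sum_distrib_left by (rule sum.swap)
    also have "\<dots> \<le> (\<Sum>e\<in>arcs G. R1 * (LINT x|edge e. F e x))"
      using edge_bound[OF S] by (rule sum_mono)
    finally show ?thesis .
  qed
  then show ?thesis by blast
qed

text \<open>
  Convergence of \<Sum> 1 / (1 + lam k) forces lam k > 1 for large k, and then 1 / lam k \<le> 2 / (1 + lam k).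
\<close>

lemma summable_inverse_lam: "summable (\<lambda>k. 1 / lam k)"
proof -
  obtain B where B: "\<And>S. finite S \<Longrightarrow> (\<Sum>k\<in>S. damping k) \<le> B"
    using sum_damping_bounded by blast
  have sd: "summable damping"
    using damping_nonneg B by (intro summableI_nonneg_bounded[of _ B]) auto
  then have "damping \<longlonglongrightarrow> 0" by (rule summable_LIMSEQ_zero)
  then have "eventually (\<lambda>k. damping k < 1 / 2) sequentially"
    by (rule order_tendstoD) simp
  then have "eventually (\<lambda>k. norm (1 / lam k) \<le> 2 * damping k) sequentially"
  proof eventually_elim
    case (elim k)
    then have "1 < lam k" using lam_nonneg[of k] by (simp add: damping_def field_simps)
    then show ?case by (simp add: damping_def field_simps)
  qed
  then show ?thesis
    using sd by (rule summable_comparison_test_ev[OF _ summable_mult])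
qed

lemma vertex_value_le:
  assumes v: "has_vertex_value G l (\<lambda>e. RL_integral (1 - \<beta>) (u k e)) v y"
    and e: "e \<in> arcs G" "tail G e = v \<or> head G e = v"
  shows "\<bar>y\<bar> \<le> (sqrt (singular_part_bound \<beta> a0 R0 (l e)) + sqrt (l e / a0)) * (1 + sqrt (lam k))"
    (is "_ \<le> ?B")
proof -
  let ?y = "RL_integral (1 - \<beta>) (u k e)"
  have le: "eventually (\<lambda>x. \<bar>?y x\<bar> \<le> ?B) F" if "eventually (\<lambda>x. x \<in> {0<..<l e}) F" for F
    using that by eventually_elim (rule abs_RL_u_le[OF e(1)])
  have a: "0 < l e" using length_pos[OF e(1)] .
  from e(2) show ?thesis
  proof
    assume "tail G e = v"
    then have "(?y \<longlongrightarrow> y) (at_right 0)" using v e by (simp add: has_vertex_value_def)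
    from tendsto_upperbound[OF tendsto_rabs[OF this] le] show ?thesis
      using eventually_at_right_real[OF a] by auto
  next
    assume "head G e = v"
    then have "(?y \<longlongrightarrow> y) (at_left (l e))" using v e by (simp add: has_vertex_value_def)
    from tendsto_upperbound[OF tendsto_rabs[OF this] le] show ?thesis
      using eventually_at_left_real[OF a] by auto
  qed
qed

end

section \<open>Summability and pointwise bound\<close>

text \<open>
  A boundary vertex has an arc, and any other vertex starts a nontrivial walk to it.
\<close>

lemma incident_arc_exists:
  assumes "Digraph_Component.connected G" "boundary_verts G \<noteq> {}" "v \<in> verts G"
  obtains e where "e \<in> arcs G" "tail G e = v \<or> head G e = v"
proof -
  obtain w where w: "w \<in> verts G" "card {e \<in> arcs G. tail G e = w \<or> head G e = w} = 1"
    using assms(2) by (auto simp: boundary_verts_def valency_def)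
  show thesis
  proof (cases "v = w")
    case True
    from w(2) have "{e \<in> arcs G. tail G e = w \<or> head G e = w} \<noteq> {}"
      by (metis card.empty zero_neq_one)
    then show ?thesis using that True by blast
  next
    case False
    have "(v, w) \<in> rtrancl_on (verts G) ((arcs_ends G)\<^sup>s)"
      using assms(1,3) w by (simp add: connected_conv)
    then have "(v, w) \<in> ((arcs_ends G)\<^sup>s)\<^sup>*"
      by (rule rtrancl_on_rtranclI)
    then have "v = w \<or> (\<exists>z. (v, z) \<in> (arcs_ends G)\<^sup>s)"
      by (rule converse_rtranclE) blast+
    with False obtain z where "(v, z) \<in> (arcs_ends G)\<^sup>s"
      by blast
    then show ?thesis
      using that by (auto simp: symcl_def arcs_ends_def arc_to_ends_def)
  qed
qed

theorem theorem2:
  fixes \<beta> a0 R0 :: real and E :: "'e set" and l :: "'e \<Rightarrow> real"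
  assumes "1 / 2 < \<beta>" and "\<beta> < 1" and "0 < a0" and "0 < R0"
  shows "\<exists>C. \<forall>(G :: ('v, 'e) pre_digraph) p r a1 R1 lam u.
    metric_graph G l \<and> arcs G = E \<and> Digraph_Component.connected G \<and> boundary_verts G \<noteq> {} \<and>
    edgewise_uniformly_continuous G l p \<and> edgewise_uniformly_continuous G l r \<and>
    (\<forall>e\<in>arcs G. \<forall>x\<in>{0<..<l e}. a0 \<le> p e x \<and> p e x \<le> a1) \<and>
    (\<forall>e\<in>arcs G. \<forall>x\<in>{0<..<l e}. R0 \<le> r e x \<and> r e x \<le> R1) \<and>
    enumerates_eigenvalues G l \<beta> p r lam \<and>
    (\<forall>k. eigenfunction G l \<beta> p r (lam k) (u k)) \<and>
    weighted_orthonormal G l r u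
    \<longrightarrow>
    summable (\<lambda>k. 1 / lam k) \<and>
    (\<forall>k. (\<forall>e\<in>arcs G. \<forall>x\<in>{0<..<l e}.
             \<bar>RL_integral (1 - \<beta>) (u k e) x\<bar> \<le> C * (1 + sqrt (lam k))) \<and>
         (\<forall>v\<in>verts G. \<forall>y. has_vertex_value G l (\<lambda>e. RL_integral (1 - \<beta>) (u k e)) v y \<longrightarrow>
             \<bar>y\<bar> \<le> C * (1 + sqrt (lam k))))"
proof -
  define C where "C e = sqrt (singular_part_bound \<beta> a0 R0 (l e)) + sqrt (l e / a0)" for e
  show ?thesis
    \<comment> \<open>E is the finite arc set of every graph in question, so that the sum dominates each of its terms\<close>
  proof (intro exI[of _ "\<Sum>e\<in>E. \<bar>C e\<bar>"] allI impI, elim conjE)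
    fix G :: "('v, 'e) pre_digraph" and p r a1 R1 lam u
    assume G: "metric_graph G l" "arcs G = E" "Digraph_Component.connected G" "boundary_verts G \<noteq> {}"
      and cont: "edgewise_uniformly_continuous G l p" "edgewise_uniformly_continuous G l r"
      and bounds: "\<forall>e\<in>arcs G. \<forall>x\<in>{0<..<l e}. a0 \<le> p e x \<and> p e x \<le> a1"
        "\<forall>e\<in>arcs G. \<forall>x\<in>{0<..<l e}. R0 \<le> r e x \<and> r e x \<le> R1"
      and eig: "\<forall>k. eigenfunction G l \<beta> p r (lam k) (u k)" and on: "weighted_orthonormal G l r u"
    interpret orthonormal_solutions G l \<beta> p r a0 a1 R0 R1 lam u
      using assms G cont bounds eig on by unfold_locales (auto simp: eigenfunction_def)
    have C_le: "C e * (1 + sqrt (lam k)) \<le> (\<Sum>e\<in>E. \<bar>C e\<bar>) * (1 + sqrt (lam k))" if "e \<in> arcs G" for e k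
    proof (rule mult_right_mono)
      have "C e \<le> \<bar>C e\<bar>" by simp
      also have "\<dots> \<le> (\<Sum>e\<in>E. \<bar>C e\<bar>)"
        using that G(2) finite_arcs by (intro member_le_sum) auto
      finally show "C e \<le> (\<Sum>e\<in>E. \<bar>C e\<bar>)" .
    qed (use lam_nonneg[of k] in simp)
    show "summable (\<lambda>k. 1 / lam k) \<and>
      (\<forall>k. (\<forall>e\<in>arcs G. \<forall>x\<in>{0<..<l e}.
             \<bar>RL_integral (1 - \<beta>) (u k e) x\<bar> \<le> (\<Sum>e\<in>E. \<bar>C e\<bar>) * (1 + sqrt (lam k))) \<and>
         (\<forall>v\<in>verts G. \<forall>y. has_vertex_value G l (\<lambda>e. RL_integral (1 - \<beta>) (u k e)) v y \<longrightarrow>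
             \<bar>y\<bar> \<le> (\<Sum>e\<in>E. \<bar>C e\<bar>) * (1 + sqrt (lam k))))"
    proof (intro conjI allI ballI impI)
      show "summable (\<lambda>k. 1 / lam k)" by (rule summable_inverse_lam)
      show "\<bar>RL_integral (1 - \<beta>) (u k e) x\<bar> \<le> (\<Sum>e\<in>E. \<bar>C e\<bar>) * (1 + sqrt (lam k))"
        if "e \<in> arcs G" "x \<in> {0<..<l e}" for k e x
        using abs_RL_u_le[OF that, of k, folded C_def] C_le[OF that(1), of k] by (rule order.trans)
      show "\<bar>y\<bar> \<le> (\<Sum>e\<in>E. \<bar>C e\<bar>) * (1 + sqrt (lam k))"
        if v: "v \<in> verts G" and y: "has_vertex_value G l (\<lambda>e. RL_integral (1 - \<beta>) (u k e)) v y" for k v y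
      proof -
        obtain e where e: "e \<in> arcs G" "tail G e = v \<or> head G e = v"
          using incident_arc_exists[OF G(3,4) v] by blast
        show ?thesis
          using vertex_value_le[OF y e, folded C_def] C_le[OF e(1), of k] by (rule order.trans)
      qed
    qed
  qed
qed

end
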